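(* Let $M$ be a proper quasi bi-slant submanifold of a cosymplectic manifold $(\bar M,\varphi,\xi,\eta,g)$. Then $\mathcal{F}$ is parallel if and only if $$g(\mathcal{A}_{\mathcal{C}V}Z_2,Z_1)=-g(\mathcal{A}_VZ_1,\mathcal{T}Z_2)$$ for all $Z_1,Z_2\in\Gamma(TM)$ and $V\in\Gamma(T^\perp M)$.
   Context: An almost contact metric manifold $(\bar M,\varphi,\xi,\eta,g)$ is an odd-dimensional smooth manifold with a $(1,1)$-tensor $\varphi$, a vector field $\xi$, a 1-form $\eta$ and a Riemannian metric $g$ such that $\varphi^2=-I+\eta\otimes\xi$, $\varphi\xi=0$, $\eta\circ\varphi=0$, $\eta(\xi)=1$, $g(\varphi X,\varphi Y)=g(X,Y)-\eta(X)\eta(Y)$, $\eta(X)=g(X,\xi)$. It is cosymplectic if $\bar\nabla\varphi=0$, where $\bar\nabla$ is the Levi-Civita connection of $g$; then also $\bar\nabla\xi=0$. Let $M$ be a Riemannian manifold isometrically immersed in $\bar M$ (induced metric also denoted $g$). The induced connection $\nabla$, second fundamental form $h$, shape operators $\mathcal{A}_V$ and normal connection $\nabla^\perp$ are given by $\bar\nabla_XY=\nabla_XY+h(X,Y)$ and $\bar\nabla_XV=-\mathcal{A}_VX+\nabla^\perp_XV$ for $X,Y\in\Gamma(TM)$, $V\in\Gamma(T^\perp M)$. $M$ is a quasi bi-slant submanifold if $\xi$ is tangent to $M$ and there is an orthogonal decomposition $TM=\mathcal{D}\oplus\mathcal{D}_1\oplus\mathcal{D}_2\oplus\langle\xi\rangle$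 into distributions such that: $\varphi\mathcal{D}=\mathcal{D}$; $\varphi\mathcal{D}_1\perp\mathcal{D}_2$ and $\varphi\mathcal{D}_2\perp\mathcal{D}_1$; and for $i=1,2$ the distribution $\mathcal{D}_i$ is slant with slant angle $\theta_i$, i.e. for every $p\in M$ and every nonzero $X\in(\mathcal{D}_i)_p$ the angle between $\varphi X$ and $(\mathcal{D}_i)_p$ equals the constant $\theta_i$. It is proper if $\mathcal{D},\mathcal{D}_1,\mathcal{D}_2$ all have nonzero rank and $\theta_1,\theta_2\notin\{0,\frac{\pi}{2}\}$. For $X\in\Gamma(TM)$ write $\varphi X=\mathcal{T}X+\mathcal{F}X$, and for $V\in\Gamma(T^\perp M)$ write $\varphi V=\mathcal{B}V+\mathcal{C}V$, where $\mathcal{T}X,\mathcal{B}V$ are tangent and $\mathcal{F}X,\mathcal{C}V$ are normal to $M$. Define $(\bar\nabla_{Z_1}\mathcal{F})Z_2=\nabla^\perp_{Z_1}\mathcal{F}Z_2-\mathcal{F}\nabla_{Z_1}Z_2$ for $Z_1,Z_2\in\Gamma(TM)$; $\mathcal{F}$ is parallel if $\bar\nabla\mathcal{F}\equiv0$. *)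

theory Defs
  imports "HOL-Analysis.Analysis"
begin

section \<open>Smooth manifolds\<close>

text \<open>Used for open \<open>S\<close> only.\<close>

primrec Ck_on ::
  "nat \<Rightarrow> 'a::real_normed_vector set \<Rightarrow> ('a \<Rightarrow> 'b::real_normed_vector) \<Rightarrow> bool" where
  "Ck_on 0 S h \<longleftrightarrow> continuous_on S h"
| "Ck_on (Suc k) S h \<longleftrightarrow>
     (\<forall>x\<in>S. h differentiable at x) \<and> (\<forall>v. Ck_on k S (\<lambda>x. frechet_derivative h (at x) v))"

definition Cinf_on ::
  "'a::real_normed_vector set \<Rightarrow> ('a \<Rightarrow> 'b::real_normed_vector) \<Rightarrow> bool" where
  "Cinf_on S h \<longleftrightarrow> (\<forall>k. Ck_on k S h)"

text \<open>A chart is a pair of its domain and its coordinate map; \<open>param\<close> is the inverse of the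
  coordinate map. A manifold is a Hausdorff, second countable type \<open>'m\<close> (all of \<open>UNIV\<close>) with an
  atlas of charts into the model space \<open>'e\<close>, so its dimension is \<open>DIM('e)\<close>.\<close>

type_synonym ('m, 'e) chart = "'m set \<times> ('m \<Rightarrow> 'e)"

definition param :: "('m, 'e) chart \<Rightarrow> 'e \<Rightarrow> 'm" where
  "param c = inv_into (fst c) (snd c)"

definition is_chart ::
  "('m::topological_space, 'e::euclidean_space) chart \<Rightarrow> bool" where
  "is_chart c \<longleftrightarrow> open (fst c) \<and> open (snd c ` fst c) \<and>
     homeomorphism (fst c) (snd c ` fst c) (snd c) (param c)"

definition smooth_atlas ::
  "('m::{t2_space, second_countable_topology}, 'e::euclidean_space) chart set \<Rightarrow> bool" where
  "smooth_atlas A \<longleftrightarrow> (\<forall>c\<in>A. is_chart c) \<and> (\<Union>c\<in>A. fst c) = UNIV \<and>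
     (\<forall>c\<in>A. \<forall>d\<in>A. Cinf_on (snd c ` (fst c \<inter> fst d)) (snd d \<circ> param c))"

definition smooth_fun ::
  "('m, 'e::euclidean_space) chart set \<Rightarrow> 'm set \<Rightarrow> ('m \<Rightarrow> 'b::real_normed_vector) \<Rightarrow> bool" where
  "smooth_fun A U h \<longleftrightarrow> (\<forall>c\<in>A. Cinf_on (snd c ` (U \<inter> fst c)) (h \<circ> param c))"

definition smooth_map ::
  "('m::topological_space, 'd::euclidean_space) chart set \<Rightarrow>
   ('n::topological_space, 'e::euclidean_space) chart set \<Rightarrow> ('m \<Rightarrow> 'n) \<Rightarrow> bool" where
  "smooth_map A B f \<longleftrightarrow> continuous_on UNIV f \<and>
     (\<forall>d\<in>B. smooth_fun A (f -` fst d) (snd d \<circ> f))"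

section \<open>Tangent vectors and vector fields\<close>

text \<open>Every point \<open>p\<close> has a preferred chart \<open>chart_at A p\<close>, and a tangent vector at \<open>p\<close> is
  represented by its components in that chart; thus every tangent space has carrier \<open>'e\<close>, but
  the same element of \<open>'e\<close> has unrelated meanings at different points. \<open>comps A c p v\<close> are the
  components in the chart \<open>c\<close> (around \<open>p\<close>) of the tangent vector \<open>v\<close> at \<open>p\<close>, given by the
  Jacobian of the change of charts. As the preferred chart jumps with \<open>p\<close>, smoothness of a vector
  field is smoothness of its components in the charts of the atlas.\<close>

definition chart_at :: "('m, 'e) chart set \<Rightarrow> 'm \<Rightarrow> ('m, 'e) chart" where
  "chart_at A p = (SOME c. c \<in> A \<and> p \<in> fst c)"

definition dir_deriv ::
  "('m, 'e::euclidean_space) chart set \<Rightarrow> ('m \<Rightarrow> 'b::real_normed_vector) \<Rightarrow> 'm \<Rightarrow> 'e \<Rightarrow> 'b" where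
  "dir_deriv A h p v =
     frechet_derivative (h \<circ> param (chart_at A p)) (at (snd (chart_at A p) p)) v"

definition comps ::
  "('m, 'e::euclidean_space) chart set \<Rightarrow> ('m, 'e) chart \<Rightarrow> 'm \<Rightarrow> 'e \<Rightarrow> 'e" where
  "comps A c p v = dir_deriv A (snd c) p v"

definition differential ::
  "('m, 'd::euclidean_space) chart set \<Rightarrow> ('n, 'e::euclidean_space) chart set \<Rightarrow>
   ('m \<Rightarrow> 'n) \<Rightarrow> 'm \<Rightarrow> 'd \<Rightarrow> 'e" where
  "differential A B f p v = dir_deriv A (snd (chart_at B (f p)) \<circ> f) p v"

text \<open>\<open>smooth_along A B f U W\<close>: \<open>W\<close> is a smooth vector field along \<open>f\<close> over the open set \<open>U\<close>,
  with \<open>W q\<close> tangent to the target at \<open>f q\<close>. Values outside \<open>U\<close> are irrelevant, so this also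
  encodes local sections.\<close>

definition smooth_along ::
  "('m, 'd::euclidean_space) chart set \<Rightarrow> ('n, 'e::euclidean_space) chart set \<Rightarrow>
   ('m \<Rightarrow> 'n) \<Rightarrow> 'm set \<Rightarrow> ('m \<Rightarrow> 'e) \<Rightarrow> bool" where
  "smooth_along A B f U W \<longleftrightarrow>
     (\<forall>d\<in>B. smooth_fun A (U \<inter> f -` fst d) (\<lambda>q. comps B d (f q) (W q)))"

definition smooth_field ::
  "('m, 'e::euclidean_space) chart set \<Rightarrow> 'm set \<Rightarrow> ('m \<Rightarrow> 'e) \<Rightarrow> bool" where
  "smooth_field A U X \<longleftrightarrow> smooth_along A A id U X"

text \<open>The coordinate formula for the Lie bracket, in the preferred chart at \<open>p\<close>.\<close>

definition lie_bracket ::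
  "('m, 'e::euclidean_space) chart set \<Rightarrow> ('m \<Rightarrow> 'e) \<Rightarrow> ('m \<Rightarrow> 'e) \<Rightarrow> 'm \<Rightarrow> 'e" where
  "lie_bracket A X Y p =
     dir_deriv A (\<lambda>q. comps A (chart_at A p) q (Y q)) p (X p) -
     dir_deriv A (\<lambda>q. comps A (chart_at A p) q (X q)) p (Y p)"

text \<open>A smooth distribution of constant rank, given by its fibres.\<close>

definition distribution ::
  "('m::topological_space, 'e::euclidean_space) chart set \<Rightarrow> ('m \<Rightarrow> 'e set) \<Rightarrow> bool" where
  "distribution A \<Delta> \<longleftrightarrow>
     (\<exists>k. \<forall>p. subspace (\<Delta> p) \<and> dim (\<Delta> p) = k \<and>
       (\<exists>U (E :: nat \<Rightarrow> 'm \<Rightarrow> 'e). open U \<and> p \<in> U \<and> (\<forall>i<k. smooth_field A U (E i)) \<and>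
          (\<forall>q\<in>U. \<Delta> q = span ((\<lambda>i. E i q) ` {..<k}))))"

section \<open>Riemannian metrics and connections\<close>

record ('m, 'e) riem =
  atlas :: "('m, 'e) chart set"
  metric :: "'m \<Rightarrow> 'e \<Rightarrow> 'e \<Rightarrow> real"

definition riemannian_manifold ::
  "('m::{t2_space, second_countable_topology}, 'e::euclidean_space, 'z) riem_scheme \<Rightarrow> bool" where
  "riemannian_manifold M \<longleftrightarrow> smooth_atlas (atlas M) \<and>
     (\<forall>p. bilinear (metric M p)) \<and>
     (\<forall>p u v. metric M p u v = metric M p v u) \<and>
     (\<forall>p u. u \<noteq> 0 \<longrightarrow> metric M p u u > 0) \<and>
     (\<forall>U X Y. open U \<and> smooth_field (atlas M) U X \<and> smooth_field (atlas M) U Y \<longrightarrow>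
        smooth_fun (atlas M) U (\<lambda>p. metric M p (X p) (Y p)))"

text \<open>\<open>nabla p v W\<close> is the covariant derivative at \<open>p\<close>, in direction \<open>v\<close>, of the vector field
  \<open>W\<close> along \<open>f\<close>, i.e. we have a connection in the pullback along \<open>f\<close> of the tangent bundle of the
  target. The axioms are imposed on local sections; the Leibniz rule then forces \<open>nabla p v W\<close> to
  depend only on the germ of \<open>W\<close> at \<open>p\<close>. For \<open>f = id\<close> this is an affine connection.\<close>

definition connection_along ::
  "('m::topological_space, 'd::euclidean_space) chart set \<Rightarrow> ('n, 'e::euclidean_space) chart set \<Rightarrow>
   ('m \<Rightarrow> 'n) \<Rightarrow> ('m \<Rightarrow> 'd \<Rightarrow> ('m \<Rightarrow> 'e) \<Rightarrow> 'e) \<Rightarrow> bool" where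
  "connection_along A B f nabla \<longleftrightarrow> (\<forall>U W. open U \<and> smooth_along A B f U W \<longrightarrow>
     (\<forall>p\<in>U. linear (\<lambda>v. nabla p v W)) \<and>
     (\<forall>W'. smooth_along A B f U W' \<longrightarrow>
        (\<forall>p\<in>U. \<forall>v. nabla p v (\<lambda>q. W q + W' q) = nabla p v W + nabla p v W')) \<and>
     (\<forall>h :: 'm \<Rightarrow> real. smooth_fun A U h \<longrightarrow>
        (\<forall>p\<in>U. \<forall>v. nabla p v (\<lambda>q. h q *\<^sub>R W q) =
           dir_deriv A h p v *\<^sub>R W p + h p *\<^sub>R nabla p v W)) \<and>
     (\<forall>X. smooth_field A U X \<longrightarrow> smooth_along A B f U (\<lambda>p. nabla p (X p) W)))"

definition levi_civita ::
  "('n::topological_space, 'e::euclidean_space, 'z) riem_scheme \<Rightarrow>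
   ('n \<Rightarrow> 'e \<Rightarrow> ('n \<Rightarrow> 'e) \<Rightarrow> 'e) \<Rightarrow> bool" where
  "levi_civita N nabla \<longleftrightarrow> connection_along (atlas N) (atlas N) id nabla \<and>
     (\<forall>U X Y. open U \<and> smooth_field (atlas N) U X \<and> smooth_field (atlas N) U Y \<longrightarrow>
        (\<forall>p\<in>U. nabla p (X p) Y - nabla p (Y p) X = lie_bracket (atlas N) X Y p)) \<and>
     (\<forall>U X Y. open U \<and> smooth_field (atlas N) U X \<and> smooth_field (atlas N) U Y \<longrightarrow>
        (\<forall>p\<in>U. \<forall>v. dir_deriv (atlas N) (\<lambda>q. metric N q (X q) (Y q)) p v =
           metric N p (nabla p v X) (Y p) + metric N p (X p) (nabla p v Y)))"

text \<open>The pullback of a connection \<open>nabla\<close> on the target along \<open>f\<close>: the unique connection along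
  \<open>f\<close> determined on the fields \<open>Y \<circ> f\<close> by the chain rule. For a submanifold it is what is meant by
  \<open>nabla\<close> applied to vector fields defined only along the submanifold.\<close>

definition pullback_connection ::
  "('m::topological_space, 'd::euclidean_space) chart set \<Rightarrow>
   ('n::topological_space, 'e::euclidean_space) chart set \<Rightarrow> ('m \<Rightarrow> 'n) \<Rightarrow>
   ('n \<Rightarrow> 'e \<Rightarrow> ('n \<Rightarrow> 'e) \<Rightarrow> 'e) \<Rightarrow> ('m \<Rightarrow> 'd \<Rightarrow> ('m \<Rightarrow> 'e) \<Rightarrow> 'e) \<Rightarrow> bool" where
  "pullback_connection A B f nabla D \<longleftrightarrow> connection_along A B f D \<and>
     (\<forall>V Y. open V \<and> smooth_field B V Y \<longrightarrow>
        (\<forall>p. f p \<in> V \<longrightarrow> (\<forall>v. D p v (\<lambda>q. Y (f q)) = nabla (f p) (differential A B f p v) Y)))"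

section \<open>Cosymplectic manifolds\<close>

record ('n, 'e) acm = "('n, 'e) riem" +
  phi :: "'n \<Rightarrow> 'e \<Rightarrow> 'e"
  xi :: "'n \<Rightarrow> 'e"
  eta :: "'n \<Rightarrow> 'e \<Rightarrow> real"

definition almost_contact_metric ::
  "('n::{t2_space, second_countable_topology}, 'e::euclidean_space) acm \<Rightarrow> bool" where
  "almost_contact_metric N \<longleftrightarrow> odd DIM('e) \<and> riemannian_manifold N \<and>
     (\<forall>p. linear (phi N p)) \<and> (\<forall>p. linear (eta N p)) \<and>
     (\<forall>U X. open U \<and> smooth_field (atlas N) U X \<longrightarrow>
        smooth_field (atlas N) U (\<lambda>p. phi N p (X p)) \<and>
        smooth_fun (atlas N) U (\<lambda>p. eta N p (X p))) \<and>
     smooth_field (atlas N) UNIV (xi N) \<and>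
     (\<forall>p u. phi N p (phi N p u) = - u + eta N p u *\<^sub>R xi N p) \<and>
     (\<forall>p. phi N p (xi N p) = 0) \<and>
     (\<forall>p u. eta N p (phi N p u) = 0) \<and>
     (\<forall>p. eta N p (xi N p) = 1) \<and>
     (\<forall>p u v. metric N p (phi N p u) (phi N p v) = metric N p u v - eta N p u * eta N p v) \<and>
     (\<forall>p u. eta N p u = metric N p u (xi N p))"

text \<open>The last clause is the vanishing of the covariant derivative of \<open>phi\<close>.\<close>

definition cosymplectic ::
  "('n::{t2_space, second_countable_topology}, 'e::euclidean_space) acm \<Rightarrow>
   ('n \<Rightarrow> 'e \<Rightarrow> ('n \<Rightarrow> 'e) \<Rightarrow> 'e) \<Rightarrow> bool" where
  "cosymplectic N nabla \<longleftrightarrow> almost_contact_metric N \<and> levi_civita N nabla \<and>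
     (\<forall>U Y. open U \<and> smooth_field (atlas N) U Y \<longrightarrow>
        (\<forall>p\<in>U. \<forall>v. nabla p v (\<lambda>q. phi N q (Y q)) - phi N p (nabla p v Y) = 0))"

section \<open>Isometric immersions\<close>

text \<open>Vectors tangent to \<open>M\<close> at \<open>p\<close> are elements of \<open>'d\<close>; their images under \<open>push M N f p\<close> are
  ambient vectors, i.e. elements of \<open>'e\<close>. Normal vectors are ambient vectors.\<close>

definition push ::
  "('m, 'd::euclidean_space, 'y) riem_scheme \<Rightarrow> ('n, 'e::euclidean_space, 'z) riem_scheme \<Rightarrow>
   ('m \<Rightarrow> 'n) \<Rightarrow> 'm \<Rightarrow> 'd \<Rightarrow> 'e" where
  "push M N f p u = differential (atlas M) (atlas N) f p u"

definition isometric_immersion ::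
  "('m::{t2_space, second_countable_topology}, 'd::euclidean_space, 'y) riem_scheme \<Rightarrow>
   ('n::{t2_space, second_countable_topology}, 'e::euclidean_space, 'z) riem_scheme \<Rightarrow>
   ('m \<Rightarrow> 'n) \<Rightarrow> bool" where
  "isometric_immersion M N f \<longleftrightarrow> riemannian_manifold M \<and> riemannian_manifold N \<and>
     smooth_map (atlas M) (atlas N) f \<and> (\<forall>p. inj (push M N f p)) \<and>
     (\<forall>p u v. metric M p u v = metric N (f p) (push M N f p u) (push M N f p v))"

definition normal_space ::
  "('m, 'd::euclidean_space, 'y) riem_scheme \<Rightarrow> ('n, 'e::euclidean_space, 'z) riem_scheme \<Rightarrow>
   ('m \<Rightarrow> 'n) \<Rightarrow> 'm \<Rightarrow> 'e set" where
  "normal_space M N f p = {w. \<forall>u. metric N (f p) w (push M N f p u) = 0}"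

definition tangent_part ::
  "('m, 'd::euclidean_space, 'y) riem_scheme \<Rightarrow> ('n, 'e::euclidean_space, 'z) riem_scheme \<Rightarrow>
   ('m \<Rightarrow> 'n) \<Rightarrow> 'm \<Rightarrow> 'e \<Rightarrow> 'd" where
  "tangent_part M N f p w = (THE u. w - push M N f p u \<in> normal_space M N f p)"

definition normal_part ::
  "('m, 'd::euclidean_space, 'y) riem_scheme \<Rightarrow> ('n, 'e::euclidean_space, 'z) riem_scheme \<Rightarrow>
   ('m \<Rightarrow> 'n) \<Rightarrow> 'm \<Rightarrow> 'e \<Rightarrow> 'e" where
  "normal_part M N f p w = w - push M N f p (tangent_part M N f p w)"

definition tangent_fields ::
  "('m, 'd::euclidean_space, 'y) riem_scheme \<Rightarrow> ('m \<Rightarrow> 'd) set" where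
  "tangent_fields M = {X. smooth_field (atlas M) UNIV X}"

definition normal_fields ::
  "('m, 'd::euclidean_space, 'y) riem_scheme \<Rightarrow> ('n, 'e::euclidean_space, 'z) riem_scheme \<Rightarrow>
   ('m \<Rightarrow> 'n) \<Rightarrow> ('m \<Rightarrow> 'e) set" where
  "normal_fields M N f =
     {V. smooth_along (atlas M) (atlas N) f UNIV V \<and> (\<forall>p. V p \<in> normal_space M N f p)}"

text \<open>The Gauss and Weingarten decompositions, for the pullback \<open>D\<close> of the ambient connection.\<close>

definition induced_connection ::
  "('m, 'd::euclidean_space, 'y) riem_scheme \<Rightarrow> ('n, 'e::euclidean_space, 'z) riem_scheme \<Rightarrow>
   ('m \<Rightarrow> 'n) \<Rightarrow> ('m \<Rightarrow> 'd \<Rightarrow> ('m \<Rightarrow> 'e) \<Rightarrow> 'e) \<Rightarrow> ('m \<Rightarrow> 'd) \<Rightarrow> ('m \<Rightarrow> 'd) \<Rightarrow> 'm \<Rightarrow> 'd" where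
  "induced_connection M N f D X Y p =
     tangent_part M N f p (D p (X p) (\<lambda>q. push M N f q (Y q)))"

definition shape_operator ::
  "('m, 'd::euclidean_space, 'y) riem_scheme \<Rightarrow> ('n, 'e::euclidean_space, 'z) riem_scheme \<Rightarrow>
   ('m \<Rightarrow> 'n) \<Rightarrow> ('m \<Rightarrow> 'd \<Rightarrow> ('m \<Rightarrow> 'e) \<Rightarrow> 'e) \<Rightarrow> ('m \<Rightarrow> 'e) \<Rightarrow> ('m \<Rightarrow> 'd) \<Rightarrow> 'm \<Rightarrow> 'd" where
  "shape_operator M N f D V X p = - tangent_part M N f p (D p (X p) V)"

definition normal_connection ::
  "('m, 'd::euclidean_space, 'y) riem_scheme \<Rightarrow> ('n, 'e::euclidean_space, 'z) riem_scheme \<Rightarrow>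
   ('m \<Rightarrow> 'n) \<Rightarrow> ('m \<Rightarrow> 'd \<Rightarrow> ('m \<Rightarrow> 'e) \<Rightarrow> 'e) \<Rightarrow> ('m \<Rightarrow> 'd) \<Rightarrow> ('m \<Rightarrow> 'e) \<Rightarrow> 'm \<Rightarrow> 'e" where
  "normal_connection M N f D X V p = normal_part M N f p (D p (X p) V)"

text \<open>\<open>T_op\<close>, \<open>F_op\<close> are the tangential and normal parts of \<open>phi\<close> on tangent vectors; \<open>C_op\<close> is
  the normal part of \<open>phi\<close> on normal vectors. All act pointwise.\<close>

definition T_op ::
  "('m, 'd::euclidean_space, 'y) riem_scheme \<Rightarrow> ('n, 'e::euclidean_space) acm \<Rightarrow>
   ('m \<Rightarrow> 'n) \<Rightarrow> 'm \<Rightarrow> 'd \<Rightarrow> 'd" where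
  "T_op M N f p u = tangent_part M N f p (phi N (f p) (push M N f p u))"

definition F_op ::
  "('m, 'd::euclidean_space, 'y) riem_scheme \<Rightarrow> ('n, 'e::euclidean_space) acm \<Rightarrow>
   ('m \<Rightarrow> 'n) \<Rightarrow> 'm \<Rightarrow> 'd \<Rightarrow> 'e" where
  "F_op M N f p u = normal_part M N f p (phi N (f p) (push M N f p u))"

definition C_op ::
  "('m, 'd::euclidean_space, 'y) riem_scheme \<Rightarrow> ('n, 'e::euclidean_space) acm \<Rightarrow>
   ('m \<Rightarrow> 'n) \<Rightarrow> 'm \<Rightarrow> 'e \<Rightarrow> 'e" where
  "C_op M N f p w = normal_part M N f p (phi N (f p) w)"

definition deriv_F ::
  "('m, 'd::euclidean_space, 'y) riem_scheme \<Rightarrow> ('n, 'e::euclidean_space) acm \<Rightarrow>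
   ('m \<Rightarrow> 'n) \<Rightarrow> ('m \<Rightarrow> 'd \<Rightarrow> ('m \<Rightarrow> 'e) \<Rightarrow> 'e) \<Rightarrow> ('m \<Rightarrow> 'd) \<Rightarrow> ('m \<Rightarrow> 'd) \<Rightarrow> 'm \<Rightarrow> 'e" where
  "deriv_F M N f D X Y p =
     normal_connection M N f D X (\<lambda>q. F_op M N f q (Y q)) p -
     F_op M N f p (induced_connection M N f D X Y p)"

definition F_parallel ::
  "('m, 'd::euclidean_space, 'y) riem_scheme \<Rightarrow> ('n, 'e::euclidean_space) acm \<Rightarrow>
   ('m \<Rightarrow> 'n) \<Rightarrow> ('m \<Rightarrow> 'd \<Rightarrow> ('m \<Rightarrow> 'e) \<Rightarrow> 'e) \<Rightarrow> bool" where
  "F_parallel M N f D \<longleftrightarrow>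
     (\<forall>X\<in>tangent_fields M. \<forall>Y\<in>tangent_fields M. \<forall>p. deriv_F M N f D X Y p = 0)"

section \<open>Quasi bi-slant submanifolds\<close>

definition orthogonal_wrt :: "('e \<Rightarrow> 'e \<Rightarrow> real) \<Rightarrow> 'e set \<Rightarrow> 'e set \<Rightarrow> bool" where
  "orthogonal_wrt b S S' \<longleftrightarrow> (\<forall>u\<in>S. \<forall>v\<in>S'. b u v = 0)"

text \<open>For an inner product \<open>b\<close>: the angle between two nonzero vectors, and the angle between a
  nonzero vector and a nonzero subspace as the smallest angle with a nonzero vector of it.\<close>

definition angle_vec :: "('e \<Rightarrow> 'e \<Rightarrow> real) \<Rightarrow> 'e \<Rightarrow> 'e \<Rightarrow> real" where
  "angle_vec b u v = arccos (b u v / (sqrt (b u u) * sqrt (b v v)))"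

definition angle_space :: "('e::zero \<Rightarrow> 'e \<Rightarrow> real) \<Rightarrow> 'e \<Rightarrow> 'e set \<Rightarrow> real" where
  "angle_space b u S = (INF v\<in>S - {0}. angle_vec b u v)"

definition slant ::
  "('m, 'd::euclidean_space, 'y) riem_scheme \<Rightarrow> ('n, 'e::euclidean_space) acm \<Rightarrow>
   ('m \<Rightarrow> 'n) \<Rightarrow> ('m \<Rightarrow> 'd set) \<Rightarrow> real \<Rightarrow> bool" where
  "slant M N f \<Delta> \<theta> \<longleftrightarrow> (\<forall>p. \<forall>u\<in>\<Delta> p. u \<noteq> 0 \<longrightarrow>
     angle_space (metric N (f p)) (phi N (f p) (push M N f p u)) (push M N f p ` \<Delta> p) = \<theta>)"

definition xi_line ::
  "('m, 'd::euclidean_space, 'y) riem_scheme \<Rightarrow> ('n, 'e::euclidean_space) acm \<Rightarrow>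
   ('m \<Rightarrow> 'n) \<Rightarrow> 'm \<Rightarrow> 'd set" where
  "xi_line M N f p = {u. push M N f p u \<in> span {xi N (f p)}}"

definition quasi_bi_slant ::
  "('m::{t2_space, second_countable_topology}, 'd::euclidean_space, 'y) riem_scheme \<Rightarrow>
   ('n::{t2_space, second_countable_topology}, 'e::euclidean_space) acm \<Rightarrow> ('m \<Rightarrow> 'n) \<Rightarrow>
   ('m \<Rightarrow> 'd set) \<Rightarrow> ('m \<Rightarrow> 'd set) \<Rightarrow> ('m \<Rightarrow> 'd set) \<Rightarrow> real \<Rightarrow> real \<Rightarrow> bool" where
  "quasi_bi_slant M N f \<Delta> \<Delta>1 \<Delta>2 \<theta>1 \<theta>2 \<longleftrightarrow> isometric_immersion M N f \<and>
     (\<forall>p. xi N (f p) \<in> range (push M N f p)) \<and>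
     distribution (atlas M) \<Delta> \<and> distribution (atlas M) \<Delta>1 \<and> distribution (atlas M) \<Delta>2 \<and>
     (\<forall>p. \<forall>u. \<exists>a\<in>\<Delta> p. \<exists>b\<in>\<Delta>1 p. \<exists>c\<in>\<Delta>2 p. \<exists>t\<in>xi_line M N f p. u = a + b + c + t) \<and>
     (\<forall>p. orthogonal_wrt (metric M p) (\<Delta> p) (\<Delta>1 p) \<and>
          orthogonal_wrt (metric M p) (\<Delta> p) (\<Delta>2 p) \<and>
          orthogonal_wrt (metric M p) (\<Delta>1 p) (\<Delta>2 p) \<and>
          orthogonal_wrt (metric M p) (\<Delta> p) (xi_line M N f p) \<and>
          orthogonal_wrt (metric M p) (\<Delta>1 p) (xi_line M N f p) \<and>
          orthogonal_wrt (metric M p) (\<Delta>2 p) (xi_line M N f p)) \<and>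
     (\<forall>p. phi N (f p) ` (push M N f p ` \<Delta> p) = push M N f p ` \<Delta> p) \<and>
     (\<forall>p. orthogonal_wrt (metric N (f p))
            (phi N (f p) ` (push M N f p ` \<Delta>1 p)) (push M N f p ` \<Delta>2 p) \<and>
          orthogonal_wrt (metric N (f p))
            (phi N (f p) ` (push M N f p ` \<Delta>2 p)) (push M N f p ` \<Delta>1 p)) \<and>
     slant M N f \<Delta>1 \<theta>1 \<and> slant M N f \<Delta>2 \<theta>2"

definition proper_quasi_bi_slant ::
  "('m::{t2_space, second_countable_topology}, 'd::euclidean_space, 'y) riem_scheme \<Rightarrow>
   ('n::{t2_space, second_countable_topology}, 'e::euclidean_space) acm \<Rightarrow> ('m \<Rightarrow> 'n) \<Rightarrow> bool" where
  "proper_quasi_bi_slant M N f \<longleftrightarrow>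
     (\<exists>\<Delta> \<Delta>1 \<Delta>2 \<theta>1 \<theta>2. quasi_bi_slant M N f \<Delta> \<Delta>1 \<Delta>2 \<theta>1 \<theta>2 \<and>
        (\<forall>p. dim (\<Delta> p) \<noteq> 0 \<and> dim (\<Delta>1 p) \<noteq> 0 \<and> dim (\<Delta>2 p) \<noteq> 0) \<and>
        \<theta>1 \<notin> {0, pi / 2} \<and> \<theta>2 \<notin> {0, pi / 2})"

end

theory Submission
  imports Defs
begin

text \<open>Since \<open>phi\<close> is parallel, so is its pullback along \<open>f\<close>; taking the normal part of
  \<open>D\<^sub>X (phi Y) = phi (D\<^sub>X Y)\<close> gives \<open>(D\<^sub>X F) Y = C h(X, Y) - h(X, T Y)\<close>. As \<open>phi\<close> is
  skew-adjoint, pairing with a normal field \<open>V\<close> yields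
  \<open>g ((D\<^sub>X F) Y) V = - g (A\<^bsub>CV\<^esub> Y) X - g (A\<^sub>V X) (T Y)\<close>, where the first term uses the symmetry of
  the second fundamental form \<open>h\<close>. For the converse no extension of normal vectors to normal fields is
  needed: \<open>V = (D\<^sub>X F) Y\<close> is itself a smooth normal field, and the identity says that its norm vanishes.
  The properties of the ambient connection pass to the pullback by expanding fields along \<open>f\<close> in
  coordinate frames of the target; smoothness of tangential parts follows from a smooth local
  orthogonal frame.\<close>

section \<open>Smooth functions on normed spaces\<close>


text \<open>The deepest ingredient is the symmetry of \<open>h\<close>. A tangent field of the
  submanifold, once pushed forward, is only a field along \<open>f\<close>, so the vanishing torsion
  of \<open>nabla\<close> says nothing about it directly. In a chart of the target,
  \<open>D\<^sub>v (df Z)\<close> is a second derivative of the coordinates of \<open>f\<close> plus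
  a term in the Christoffel symbols. Exchanging \<open>X\<close> and \<open>Y\<close> changes the
  former by the derivative along the Lie bracket, because mixed partial derivatives commute, and
  leaves the latter unchanged, because coordinate fields commute. The commutation of derivatives is
  proved for \<open>Ck_on\<close>, whose recursion differentiates in fixed directions only; hence
  the repeated expansions in \<open>Basis\<close>. Fields are total functions, arbitrary outside the
  set considered, and the preferred chart jumps from point to point, so smoothness is always checked
  near a point in one fixed chart. Smooth tangential parts are needed twice: \<open>T Y\<close> must
  be a tangent field for the Weingarten formula to apply to it, and \<open>(D\<^sub>X F) Y\<close>
  must be an admissible \<open>V\<close>.\<close>

abbreviation fderiv :: "('a::real_normed_vector \<Rightarrow> 'b::real_normed_vector) \<Rightarrow> 'a \<Rightarrow> 'a \<Rightarrow> 'b" where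
  "fderiv h x v \<equiv> frechet_derivative h (at x) v"

lemma fderiv_eqI:
  assumes "(h has_derivative h') (at x)"
  shows "fderiv h x v = h' v"
  using frechet_derivative_at[OF assms] by simp

lemma has_derivative_fderiv:
  "h differentiable at x \<Longrightarrow> (h has_derivative fderiv h x) (at x)"
  by (simp add: frechet_derivative_works)

lemma fderiv_cong:
  assumes "open S" "x \<in> S" "\<And>y. y \<in> S \<Longrightarrow> f y = g y" "f differentiable at x"
  shows "g differentiable at x" "fderiv g x v = fderiv f x v"
proof -
  have "(g has_derivative fderiv f x) (at x)"
    using has_derivative_transform_within_open[OF has_derivative_fderiv[OF assms(4)] assms(1,2)] assms(3)
    by simp
  then show "g differentiable at x" "fderiv g x v = fderiv f x v"
    by (auto simp: differentiable_def fderiv_eqI)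
qed

lemma fderiv_compose:
  assumes "f differentiable at x" "g differentiable at (f x)"
  shows "(\<lambda>y. g (f y)) differentiable at x"
    and "fderiv (\<lambda>y. g (f y)) x v = fderiv g (f x) (fderiv f x v)"
proof -
  have "((\<lambda>y. g (f y)) has_derivative (\<lambda>v. fderiv g (f x) (fderiv f x v))) (at x)"
    by (rule has_derivative_compose[OF has_derivative_fderiv[OF assms(1)] has_derivative_fderiv[OF assms(2)]])
  then show "(\<lambda>y. g (f y)) differentiable at x"
    "fderiv (\<lambda>y. g (f y)) x v = fderiv g (f x) (fderiv f x v)"
    by (auto simp: differentiable_def fderiv_eqI)
qed

text \<open>\<open>Ck_on\<close> controls derivatives in fixed directions only. Expanding in
  \<open>Basis\<close> reduces a direction that moves with the point to these.\<close>

lemma fderiv_expand: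
  fixes g :: "'a::euclidean_space \<Rightarrow> 'b::real_normed_vector"
  assumes "g differentiable at x"
  shows "fderiv g x v = (\<Sum>b\<in>Basis. (v \<bullet> b) *\<^sub>R fderiv g x b)"
proof -
  have "fderiv g x v = fderiv g x (\<Sum>b\<in>Basis. (v \<bullet> b) *\<^sub>R b)"
    by (simp add: euclidean_representation)
  then show ?thesis
    using linear_frechet_derivative[OF assms] by (simp add: linear_sum linear_scale)
qed

section \<open>Closure properties of finite and infinite differentiability\<close>

text \<open>On an open set, agreement of two functions passes to their derivatives, so the recursion
  can go on. The closure proofs below use this to pass from an explicit formula for a derivative to
  \<open>frechet_derivative\<close> itself.\<close>

lemma Ck_on_cong:
  assumes "open S" "\<And>x. x \<in> S \<Longrightarrow> f x = g x" "Ck_on k S f"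
  shows "Ck_on k S g"
  using assms(2,3)
proof (induction k arbitrary: f g)
  case 0
  then show ?case by (metis Ck_on.simps(1) continuous_on_cong)
next
  case (Suc k)
  have d: "f differentiable at x" if "x \<in> S" for x using Suc.prems(2) that by simp
  have "Ck_on k S (\<lambda>x. fderiv g x v)" for v
  proof (rule Suc.IH[of "\<lambda>x. fderiv f x v"])
    show "fderiv f x v = fderiv g x v" if "x \<in> S" for x
      by (rule fderiv_cong(2)[OF assms(1) that Suc.prems(1) d[OF that], symmetric])
    show "Ck_on k S (\<lambda>x. fderiv f x v)" using Suc.prems(2) by simp
  qed
  then show ?case using fderiv_cong(1)[OF assms(1) _ Suc.prems(1) d] by auto
qed

lemma Ck_on_subset: "Ck_on k S f \<Longrightarrow> T \<subseteq> S \<Longrightarrow> Ck_on k T f"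
  by (induction k arbitrary: f) (auto intro: continuous_on_subset)

lemma Ck_on_Union:
  assumes "\<And>x. x \<in> S \<Longrightarrow> \<exists>T. open T \<and> x \<in> T \<and> Ck_on k T f"
  shows "Ck_on k S f"
  using assms
proof (induction k arbitrary: f)
  case 0
  then show ?case
    by (metis Ck_on.simps(1) continuous_at_imp_continuous_on continuous_on_eq_continuous_at)
next
  case (Suc k)
  have "Ck_on k S (\<lambda>x. fderiv f x v)" for v
    by (rule Suc.IH) (use Suc.prems in fastforce)
  moreover have "f differentiable at x" if "x \<in> S" for x
    using Suc.prems[OF that] by auto
  ultimately show ?case by simp
qed

text \<open>Differentiable functions are continuous, and this climbs up the recursion. The product
  and chain rules need it, since their derivative formulas contain the original functions beside the
  derivatives.\<close>

lemma Ck_on_SucD: "Ck_on (Suc k) S f \<Longrightarrow> Ck_on k S f"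
proof (induction k arbitrary: f)
  case 0
  then show ?case
    by (auto intro!: continuous_at_imp_continuous_on simp: differentiable_imp_continuous_within)
next
  case (Suc k)
  then show ?case by (metis Ck_on.simps(2))
qed

lemma Ck_on_const [simp]: "Ck_on k S (\<lambda>x. c)"
  by (induction k arbitrary: c) auto

lemma Ck_on_add:
  assumes "open S" "Ck_on k S f" "Ck_on k S g"
  shows "Ck_on k S (\<lambda>x. f x + g x)"
  using assms(2,3)
proof (induction k arbitrary: f g)
  case 0
  then show ?case by (simp add: continuous_on_add)
next
  case (Suc k)
  have eq: "fderiv f x v + fderiv g x v = fderiv (\<lambda>x. f x + g x) x v" if "x \<in> S" for x v
    using Suc.prems that
    by (intro fderiv_eqI[symmetric, OF has_derivative_add] has_derivative_fderiv) auto
  have ck: "Ck_on k S (\<lambda>x. fderiv f x v + fderiv g x v)" for v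
    using Suc.prems by (intro Suc.IH) auto
  have "Ck_on k S (\<lambda>x. fderiv (\<lambda>x. f x + g x) x v)" for v
    by (rule Ck_on_cong[OF assms(1) eq[of _ v] ck])
  then show ?case using Suc.prems by auto
qed

lemma Ck_on_scaleR:
  fixes c :: "'a::real_normed_vector \<Rightarrow> real"
  assumes "open S" "Ck_on k S c" "Ck_on k S g"
  shows "Ck_on k S (\<lambda>x. c x *\<^sub>R g x)"
  using assms(2,3)
proof (induction k arbitrary: c g)
  case 0
  then show ?case by (simp add: continuous_on_scaleR)
next
  case (Suc k)
  have eq: "c x *\<^sub>R fderiv g x v + fderiv c x v *\<^sub>R g x = fderiv (\<lambda>x. c x *\<^sub>R g x) x v" if "x \<in> S" for x v
    using Suc.prems that
    by (intro fderiv_eqI[symmetric, OF has_derivative_scaleR] has_derivative_fderiv) auto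
  have ck: "Ck_on k S (\<lambda>x. c x *\<^sub>R fderiv g x v + fderiv c x v *\<^sub>R g x)" for v
    using Suc.prems Ck_on_SucD[of k S c] Ck_on_SucD[of k S g]
    by (intro Ck_on_add assms(1) Suc.IH) auto
  have "Ck_on k S (\<lambda>x. fderiv (\<lambda>x. c x *\<^sub>R g x) x v)" for v
    by (rule Ck_on_cong[OF assms(1) eq[of _ v] ck])
  then show ?case using Suc.prems by auto
qed

lemma Ck_on_bounded_linear:
  assumes "open S" "Ck_on k S f" "bounded_linear L"
  shows "Ck_on k S (\<lambda>x. L (f x))"
  using assms(2)
proof (induction k arbitrary: f)
  case 0
  then show ?case using assms(3) by (simp add: linear_continuous_on_compose bounded_linear.continuous_on)
next
  case (Suc k)
  have d: "((\<lambda>x. L (f x)) has_derivative (\<lambda>v. L (fderiv f x v))) (at x)" if "x \<in> S" for x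
    using Suc.prems that by (intro bounded_linear.has_derivative[OF assms(3)] has_derivative_fderiv) auto
  have "Ck_on k S (\<lambda>x. fderiv (\<lambda>x. L (f x)) x v)" for v
  proof (rule Ck_on_cong[OF assms(1)])
    show "L (fderiv f x v) = fderiv (\<lambda>x. L (f x)) x v" if "x \<in> S" for x
      by (rule fderiv_eqI[OF d[OF that], symmetric])
    show "Ck_on k S (\<lambda>x. L (fderiv f x v))" using Suc.prems by (intro Suc.IH) simp
  qed
  then show ?case using d by (auto simp: differentiable_def)
qed

lemma Ck_on_sum:
  assumes "open S" "\<And>i. i \<in> I \<Longrightarrow> Ck_on k S (f i)"
  shows "Ck_on k S (\<lambda>x. \<Sum>i\<in>I. f i x)"
  using assms(2) by (induction I rule: infinite_finite_induct) (auto intro: Ck_on_add[OF assms(1)])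

text \<open>The induction varies \<open>g\<close> and keeps \<open>f\<close>: by the chain rule and
  an expansion in \<open>Basis\<close>, a derivative of the composite is a sum of components of a
  derivative of \<open>f\<close> times partial derivatives of \<open>g\<close> composed with the
  same \<open>f\<close>.\<close>

lemma Ck_on_compose:
  fixes f :: "'a::real_normed_vector \<Rightarrow> 'b::euclidean_space"
  assumes "open S" "open T" "f ` S \<subseteq> T" "Ck_on k S f" "Ck_on k T g"
  shows "Ck_on k S (\<lambda>x. g (f x))"
  using assms(4,5)
proof (induction k arbitrary: g)
  case 0
  then show ?case using assms(3) by (auto intro: continuous_on_compose2)
next
  case (Suc k)
  have df: "f differentiable at x" "g differentiable at (f x)" if "x \<in> S" for x
    using that Suc.prems assms(3) by auto
  have eq: "(\<Sum>b\<in>Basis. (fderiv f x v \<bullet> b) *\<^sub>R fderiv g (f x) b) = fderiv (\<lambda>x. g (f x)) x v"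
    if "x \<in> S" for x v
    by (rule trans[OF fderiv_expand[OF df(2)[OF that], symmetric]
          fderiv_compose(2)[OF df[OF that], symmetric]])
  have ck: "Ck_on k S (\<lambda>x. \<Sum>b\<in>Basis. (fderiv f x v \<bullet> b) *\<^sub>R fderiv g (f x) b)" for v
    using Suc.prems Ck_on_SucD[of k S f]
    by (intro Ck_on_sum Ck_on_scaleR assms(1) Suc.IH
        Ck_on_bounded_linear[where L = "\<lambda>x. x \<bullet> _"] bounded_linear_inner_left) auto
  have "Ck_on k S (\<lambda>x. fderiv (\<lambda>x. g (f x)) x v)" for v
    by (rule Ck_on_cong[OF assms(1) eq[of _ v] ck])
  then show ?case using fderiv_compose(1)[OF df] by auto
qed

text \<open>The derivative of the reciprocal contains the reciprocal itself, so one order of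
  smoothness of \<open>inverse (c x)\<close> yields the next by the product rule.\<close>

lemma Ck_on_inverse:
  fixes c :: "'a::real_normed_vector \<Rightarrow> real"
  assumes "open S" "Ck_on k S c" "\<And>x. x \<in> S \<Longrightarrow> c x \<noteq> 0"
  shows "Ck_on k S (\<lambda>x. inverse (c x))"
  using assms(2)
proof (induction k)
  case 0
  then show ?case using assms(3) by (auto intro: continuous_on_inverse)
next
  case (Suc k)
  have d: "((\<lambda>x. inverse (c x)) has_derivative (\<lambda>v. - (inverse (c x) * fderiv c x v * inverse (c x)))) (at x)"
    if "x \<in> S" for x
    using Suc.prems that assms(3)[OF that]
    by (auto intro!: derivative_eq_intros has_derivative_fderiv)
  have eq: "(- 1) *\<^sub>R (inverse (c x) *\<^sub>R (inverse (c x) *\<^sub>R fderiv c x v)) = fderiv (\<lambda>x. inverse (c x)) x v"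
    if "x \<in> S" for x v
    by (simp add: fderiv_eqI[OF d[OF that]])
  have ck: "Ck_on k S (\<lambda>x. (- 1) *\<^sub>R (inverse (c x) *\<^sub>R (inverse (c x) *\<^sub>R fderiv c x v)))" for v
    using Suc.prems Suc.IH[OF Ck_on_SucD[OF Suc.prems]] by (intro Ck_on_scaleR assms(1)) auto
  have "Ck_on k S (\<lambda>x. fderiv (\<lambda>x. inverse (c x)) x v)" for v
    by (rule Ck_on_cong[OF assms(1) eq[of _ v] ck])
  then show ?case using d by (auto simp: differentiable_def)
qed

lemma Ck_on_ident: "Ck_on k S (\<lambda>x. x)"
  by (cases k) auto

lemma Cinf_onD:
  assumes "Cinf_on S f"
  shows "x \<in> S \<Longrightarrow> f differentiable at x" "Cinf_on S (\<lambda>x. fderiv f x v)"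
  using assms unfolding Cinf_on_def by (metis Ck_on.simps(2))+

lemma Cinf_on_cong:
  "open S \<Longrightarrow> (\<And>x. x \<in> S \<Longrightarrow> f x = g x) \<Longrightarrow> Cinf_on S f \<Longrightarrow> Cinf_on S g"
  unfolding Cinf_on_def by (meson Ck_on_cong)

lemma Cinf_on_subset: "Cinf_on S f \<Longrightarrow> T \<subseteq> S \<Longrightarrow> Cinf_on T f"
  unfolding Cinf_on_def by (meson Ck_on_subset)

lemma Cinf_on_Union:
  "(\<And>x. x \<in> S \<Longrightarrow> \<exists>T. open T \<and> x \<in> T \<and> Cinf_on T f) \<Longrightarrow> Cinf_on S f"
  unfolding Cinf_on_def by (meson Ck_on_Union)

lemma Cinf_on_const: "Cinf_on S (\<lambda>x. c)"
  by (simp add: Cinf_on_def)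

lemma Cinf_on_ident: "Cinf_on S (\<lambda>x. x)"
  by (simp add: Cinf_on_def Ck_on_ident)

lemma Cinf_on_add: "open S \<Longrightarrow> Cinf_on S f \<Longrightarrow> Cinf_on S g \<Longrightarrow> Cinf_on S (\<lambda>x. f x + g x)"
  by (simp add: Cinf_on_def Ck_on_add)

lemma Cinf_on_scaleR:
  "open S \<Longrightarrow> Cinf_on S c \<Longrightarrow> Cinf_on S f \<Longrightarrow> Cinf_on S (\<lambda>x. c x *\<^sub>R f x)"
  by (simp add: Cinf_on_def Ck_on_scaleR)

lemma Cinf_on_bounded_linear:
  "open S \<Longrightarrow> Cinf_on S f \<Longrightarrow> bounded_linear L \<Longrightarrow> Cinf_on S (\<lambda>x. L (f x))"
  by (simp add: Cinf_on_def Ck_on_bounded_linear)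

lemma Cinf_on_inverse:
  fixes c :: "'a::real_normed_vector \<Rightarrow> real"
  shows "open S \<Longrightarrow> Cinf_on S c \<Longrightarrow> (\<And>x. x \<in> S \<Longrightarrow> c x \<noteq> 0) \<Longrightarrow> Cinf_on S (\<lambda>x. inverse (c x))"
  by (simp add: Cinf_on_def Ck_on_inverse)

lemma Cinf_on_compose:
  fixes f :: "'a::real_normed_vector \<Rightarrow> 'b::euclidean_space"
  shows "open S \<Longrightarrow> open T \<Longrightarrow> f ` S \<subseteq> T \<Longrightarrow> Cinf_on S f \<Longrightarrow> Cinf_on T g \<Longrightarrow> Cinf_on S (\<lambda>x. g (f x))"
  unfolding Cinf_on_def by (auto intro: Ck_on_compose[of S T f])

text \<open>Both the base point and the direction may move here. This is the form in which Jacobians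
  of chart changes act on the components of a field.\<close>

lemma Cinf_on_fderiv:
  fixes f :: "'a::real_normed_vector \<Rightarrow> 'b::euclidean_space"
  assumes "open S" "open T" "f ` S \<subseteq> T" "Cinf_on S f" "Cinf_on T g" "Cinf_on S w"
  shows "Cinf_on S (\<lambda>x. fderiv g (f x) (w x))"
proof -
  have "Cinf_on S (\<lambda>x. fderiv g (f x) b)" for b
    by (rule Cinf_on_compose[OF assms(1-4) Cinf_onD(2)[OF assms(5)]])
  then have "Cinf_on S (\<lambda>x. \<Sum>b\<in>Basis. (w x \<bullet> b) *\<^sub>R fderiv g (f x) b)"
    using assms(6) unfolding Cinf_on_def
    by (auto intro!: Ck_on_sum[OF assms(1)] Ck_on_scaleR[OF assms(1)]
        Ck_on_bounded_linear[OF assms(1), where L = "\<lambda>x. x \<bullet> _"] bounded_linear_inner_left)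
  then show ?thesis
    using assms(3) fderiv_expand[OF Cinf_onD(1)[OF assms(5)], symmetric]
    by (intro Cinf_on_cong[OF assms(1) _ \<open>Cinf_on S (\<lambda>x. \<Sum>b\<in>Basis. (w x \<bullet> b) *\<^sub>R fderiv g (f x) b)\<close>]) auto
qed

section \<open>Symmetry of second derivatives\<close>

text \<open>The mean value theorem is applied twice: to the increment along \<open>w\<close> as a
  function of the coefficient of \<open>v\<close>, then to the resulting derivative along
  \<open>v\<close> as a function of the coefficient of \<open>w\<close>. The bound on
  \<open>s\<close> keeps the whole parallelogram in the ball.\<close>

lemma second_difference:
  fixes f :: "'a::real_normed_vector \<Rightarrow> real"
  assumes S: "Cinf_on S f" "ball x d \<subseteq> S" and s: "0 < s" "s * norm v + s * norm w < d"
  shows "\<exists>y\<in>ball x d. f (x + s *\<^sub>R v + s *\<^sub>R w) - f (x + s *\<^sub>R v) - f (x + s *\<^sub>R w) + f x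
           = s * s * fderiv (\<lambda>y. fderiv f y v) y w"
proof -
  have inS: "x + a *\<^sub>R v + b *\<^sub>R w \<in> ball x d" if "0 \<le> a" "a \<le> s" "0 \<le> b" "b \<le> s" for a b
  proof -
    have "norm (a *\<^sub>R v + b *\<^sub>R w) \<le> a * norm v + b * norm w"
      using norm_triangle_ineq[of "a *\<^sub>R v" "b *\<^sub>R w"] that by simp
    also have "\<dots> \<le> s * norm v + s * norm w"
      using that by (intro add_mono mult_right_mono) auto
    also have "\<dots> < d" by (rule s(2))
    finally show ?thesis
      unfolding mem_ball dist_commute[of x] by (simp add: dist_norm add.assoc)
  qed
  have diff: "h differentiable at (x + a *\<^sub>R v + b *\<^sub>R w)"
    if "Cinf_on S h" "0 \<le> a" "a \<le> s" "0 \<le> b" "b \<le> s" for a b and h :: "'a \<Rightarrow> real"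
    using inS[OF that(2-)] Cinf_onD(1)[OF that(1)] S(2) by auto
  have da: "((\<lambda>a. f (x + a *\<^sub>R v + b *\<^sub>R w)) has_derivative (\<lambda>t. t * fderiv f (x + a *\<^sub>R v + b *\<^sub>R w) v)) (at a)"
    if "0 \<le> a" "a \<le> s" "0 \<le> b" "b \<le> s" for a b
  proof -
    have "((\<lambda>a. x + a *\<^sub>R v + b *\<^sub>R w) has_derivative (\<lambda>t. t *\<^sub>R v)) (at a)"
      by (auto intro!: derivative_eq_intros)
    from has_derivative_compose[OF this has_derivative_fderiv[OF diff[OF S(1) that]]]
    show ?thesis
      using linear_scale[OF linear_frechet_derivative[OF diff[OF S(1) that]]] by simp
  qed
  have db: "((\<lambda>b. fderiv f (x + a *\<^sub>R v + b *\<^sub>R w) v) has_derivative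
      (\<lambda>t. t * fderiv (\<lambda>y. fderiv f y v) (x + a *\<^sub>R v + b *\<^sub>R w) w)) (at b)"
    if "0 \<le> a" "a \<le> s" "0 \<le> b" "b \<le> s" for a b
  proof -
    note d = diff[OF Cinf_onD(2)[OF S(1)] that]
    have "((\<lambda>b. x + a *\<^sub>R v + b *\<^sub>R w) has_derivative (\<lambda>t. t *\<^sub>R w)) (at b)"
      by (auto intro!: derivative_eq_intros)
    from has_derivative_compose[OF this has_derivative_fderiv[OF d]]
    show ?thesis
      using linear_scale[OF linear_frechet_derivative[OF d]] by simp
  qed
  have "\<exists>a\<in>{0<..<s}. (f (x + s *\<^sub>R v + s *\<^sub>R w) - f (x + s *\<^sub>R v + 0 *\<^sub>R w)) -
      (f (x + 0 *\<^sub>R v + s *\<^sub>R w) - f (x + 0 *\<^sub>R v + 0 *\<^sub>R w)) =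
      (s - 0) * fderiv f (x + a *\<^sub>R v + s *\<^sub>R w) v - (s - 0) * fderiv f (x + a *\<^sub>R v + 0 *\<^sub>R w) v"
    by (rule mvt_simple[OF s(1), where f = "\<lambda>a. f (x + a *\<^sub>R v + s *\<^sub>R w) - f (x + a *\<^sub>R v + 0 *\<^sub>R w)"])
      (rule has_derivative_diff; rule has_derivative_at_withinI[OF da]; use s(1) in auto)
  then obtain a where a: "a \<in> {0<..<s}" "f (x + s *\<^sub>R v + s *\<^sub>R w) - f (x + s *\<^sub>R v) - f (x + s *\<^sub>R w) + f x
      = s * (fderiv f (x + a *\<^sub>R v + s *\<^sub>R w) v - fderiv f (x + a *\<^sub>R v + 0 *\<^sub>R w) v)"
    by (auto simp: algebra_simps)
  have "\<exists>b\<in>{0<..<s}. fderiv f (x + a *\<^sub>R v + s *\<^sub>R w) v - fderiv f (x + a *\<^sub>R v + 0 *\<^sub>R w) v =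
      (s - 0) * fderiv (\<lambda>y. fderiv f y v) (x + a *\<^sub>R v + b *\<^sub>R w) w"
    by (rule mvt_simple[OF s(1), where f = "\<lambda>b. fderiv f (x + a *\<^sub>R v + b *\<^sub>R w) v"])
      (rule has_derivative_at_withinI[OF db]; use a(1) in auto)
  then obtain b where "b \<in> {0<..<s}" "fderiv f (x + a *\<^sub>R v + s *\<^sub>R w) v - fderiv f (x + a *\<^sub>R v + 0 *\<^sub>R w) v =
      s * fderiv (\<lambda>y. fderiv f y v) (x + a *\<^sub>R v + b *\<^sub>R w) w" by auto
  then show ?thesis
    using a inS[of a b] by (intro bexI[of _ "x + a *\<^sub>R v + b *\<^sub>R w"]) auto
qed

text \<open>The second difference is unchanged when \<open>v\<close> and \<open>w\<close> are
  exchanged, so the two mixed derivatives take a common value at two points arbitrarily close to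
  \<open>x\<close>. Continuity carries the equality to \<open>x\<close>.\<close>

lemma fderiv_fderiv_commute_real:
  fixes f :: "'a::real_normed_vector \<Rightarrow> real"
  assumes S: "open S" "Cinf_on S f" "x \<in> S"
  shows "fderiv (\<lambda>y. fderiv f y v) x w = fderiv (\<lambda>y. fderiv f y w) x v"
proof (rule ccontr)
  assume ne: "fderiv (\<lambda>y. fderiv f y v) x w \<noteq> fderiv (\<lambda>y. fderiv f y w) x v"
  \<comment> \<open>Half the gap: numbers closer than \<open>e\<close> to the one and to the other
    derivative cannot coincide.\<close>
  define e where "e = \<bar>fderiv (\<lambda>y. fderiv f y v) x w - fderiv (\<lambda>y. fderiv f y w) x v\<bar> / 2"
  have e: "e > 0" using ne by (simp add: e_def)
  have "isCont (\<lambda>y. fderiv (\<lambda>y. fderiv f y v) y w) x" for v w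
    using Cinf_onD(1)[OF Cinf_onD(2)[OF Cinf_onD(2)[OF S(2)]] S(3)]
    by (rule differentiable_imp_continuous_within)
  then have *: "\<exists>d>0. \<forall>y\<in>ball x d. \<bar>fderiv (\<lambda>y. fderiv f y v) y w - fderiv (\<lambda>y. fderiv f y v) x w\<bar> < e" for v w
    using e by (force simp: continuous_at_eps_delta dist_real_def dist_commute)
  obtain d1 where d1: "d1 > 0" "\<And>y. y \<in> ball x d1 \<Longrightarrow> \<bar>fderiv (\<lambda>y. fderiv f y v) y w - fderiv (\<lambda>y. fderiv f y v) x w\<bar> < e"
    using *[of v w] by blast
  obtain d2 where d2: "d2 > 0" "\<And>y. y \<in> ball x d2 \<Longrightarrow> \<bar>fderiv (\<lambda>y. fderiv f y w) y v - fderiv (\<lambda>y. fderiv f y w) x v\<bar> < e"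
    using *[of w v] by blast
  obtain d3 where d3: "d3 > 0" "ball x d3 \<subseteq> S" using S(1,3) openE by blast
  define d where "d = min d1 (min d2 d3)"
  have d: "d > 0" "ball x d \<subseteq> S" "ball x d \<subseteq> ball x d1" "ball x d \<subseteq> ball x d2"
    using d1(1) d2(1) d3 by (auto simp: d_def)
  \<comment> \<open>Chosen so that \<open>s * norm v + s * norm w + s = d / 2\<close>; the summand
    \<open>1\<close> keeps the denominator positive even if \<open>v\<close> and \<open>w\<close>
    vanish.\<close>
  define s where "s = d / (2 * (norm v + norm w + 1))"
  have n: "norm v + norm w + 1 > 0" by (smt (verit) norm_ge_zero)
  have s: "s > 0" using d(1) n by (simp add: s_def)
  have "s * (norm v + norm w + 1) = d / 2" unfolding s_def using n by (simp add: field_simps)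
  then have "s * norm v + s * norm w + s = d / 2" by (simp only: distrib_left mult_1_right)
  then have sd: "s * norm v + s * norm w < d" using s d(1) by linarith
  obtain y1 where y1: "y1 \<in> ball x d" "f (x + s *\<^sub>R v + s *\<^sub>R w) - f (x + s *\<^sub>R v) - f (x + s *\<^sub>R w) + f x
           = s * s * fderiv (\<lambda>y. fderiv f y v) y1 w"
    using second_difference[OF S(2) d(2) s sd] by blast
  have "s * norm w + s * norm v < d" using sd by simp
  then obtain y2 where y2: "y2 \<in> ball x d" "f (x + s *\<^sub>R w + s *\<^sub>R v) - f (x + s *\<^sub>R w) - f (x + s *\<^sub>R v) + f x
           = s * s * fderiv (\<lambda>y. fderiv f y w) y2 v"
    using second_difference[OF S(2) d(2) s, of w v] by blast
  have comm: "x + s *\<^sub>R w + s *\<^sub>R v = x + s *\<^sub>R v + s *\<^sub>R w" by simp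
  have "s * s * fderiv (\<lambda>y. fderiv f y v) y1 w = s * s * fderiv (\<lambda>y. fderiv f y w) y2 v"
    using y1(2) y2(2)[unfolded comm] by linarith
  then have "fderiv (\<lambda>y. fderiv f y v) y1 w = fderiv (\<lambda>y. fderiv f y w) y2 v"
    using s by simp
  moreover have "\<bar>fderiv (\<lambda>y. fderiv f y v) y1 w - fderiv (\<lambda>y. fderiv f y v) x w\<bar> < e"
    using d1(2) d(3) y1(1) by blast
  moreover have "\<bar>fderiv (\<lambda>y. fderiv f y w) y2 v - fderiv (\<lambda>y. fderiv f y w) x v\<bar> < e"
    using d2(2) d(4) y2(1) by blast
  ultimately show False unfolding e_def by argo
qed

text \<open>Componentwise reduction to real functions, for which the mean value theorem holds as an
  equality.\<close>

lemma fderiv_fderiv_commute: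
  fixes f :: "'a::real_normed_vector \<Rightarrow> 'b::euclidean_space"
  assumes S: "open S" "Cinf_on S f" "x \<in> S"
  shows "fderiv (\<lambda>y. fderiv f y v) x w = fderiv (\<lambda>y. fderiv f y w) x v"
proof (rule euclidean_eqI)
  fix b :: 'b
  have inner: "fderiv (\<lambda>y. h y \<bullet> b) y u = fderiv h y u \<bullet> b" if "Cinf_on S h" "y \<in> S" for h y u
    by (rule fderiv_eqI[OF bounded_linear.has_derivative[OF bounded_linear_inner_left]])
      (rule has_derivative_fderiv[OF Cinf_onD(1)[OF that]])
  have *: "fderiv (\<lambda>y. fderiv (\<lambda>y. f y \<bullet> b) y u) x z = fderiv (\<lambda>y. fderiv f y u) x z \<bullet> b" for u z
  proof -
    have "fderiv (\<lambda>y. fderiv (\<lambda>y. f y \<bullet> b) y u) x z = fderiv (\<lambda>y. fderiv f y u \<bullet> b) x z"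
    proof (rule fderiv_cong(2)[OF S(1,3)])
      show "(\<lambda>y. fderiv f y u \<bullet> b) differentiable at x"
        using Cinf_onD(1)[OF Cinf_onD(2)[OF S(2)] S(3)] by (simp add: differentiable_inner)
    qed (rule inner[OF S(2), symmetric])
    then show ?thesis by (rule trans) (rule inner[OF Cinf_onD(2)[OF S(2)] S(3)])
  qed
  have "Cinf_on S (\<lambda>y. f y \<bullet> b)"
    by (rule Cinf_on_bounded_linear[OF S(1,2) bounded_linear_inner_left])
  from fderiv_fderiv_commute_real[OF S(1) this S(3)]
  show "fderiv (\<lambda>y. fderiv f y v) x w \<bullet> b = fderiv (\<lambda>y. fderiv f y w) x v \<bullet> b"
    unfolding * .
qed


text \<open>Differentiating along a field splits into a Hessian term, with the direction frozen at
  \<open>x\<close>, and a first-order term in the derivative of the field. In a commutator of two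
  fields the Hessian terms cancel and the first-order terms form the Lie bracket.\<close>

lemma fderiv_fderiv_field:
  fixes g :: "'a::euclidean_space \<Rightarrow> 'b::real_normed_vector"
  assumes "open S" "x \<in> S" "Cinf_on S g" "Cinf_on S w"
  shows "fderiv (\<lambda>y. fderiv g y (w y)) x v =
    fderiv (\<lambda>y. fderiv g y (w x)) x v + fderiv g x (fderiv w x v)"
proof -
  have dw: "((\<lambda>y. w y \<bullet> b) has_derivative (\<lambda>v. fderiv w x v \<bullet> b)) (at x)" for b
    by (rule bounded_linear.has_derivative[OF bounded_linear_inner_left])
      (rule has_derivative_fderiv[OF Cinf_onD(1)[OF assms(4,2)]])
  have dg: "((\<lambda>y. fderiv g y b) has_derivative (\<lambda>v. fderiv (\<lambda>y. fderiv g y b) x v)) (at x)" for b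
    by (rule has_derivative_fderiv[OF Cinf_onD(1)[OF Cinf_onD(2)[OF assms(3)] assms(2)]])
  have "((\<lambda>y. \<Sum>b\<in>Basis. (w y \<bullet> b) *\<^sub>R fderiv g y b) has_derivative
      (\<lambda>v. \<Sum>b\<in>Basis. (w x \<bullet> b) *\<^sub>R fderiv (\<lambda>y. fderiv g y b) x v + (fderiv w x v \<bullet> b) *\<^sub>R fderiv g x b)) (at x)"
    by (rule has_derivative_sum, rule has_derivative_scaleR[OF dw dg])
  from has_derivative_transform_within_open[OF this assms(1,2), of "\<lambda>y. fderiv g y (w y)"]
  have "((\<lambda>y. fderiv g y (w y)) has_derivative
      (\<lambda>v. \<Sum>b\<in>Basis. (w x \<bullet> b) *\<^sub>R fderiv (\<lambda>y. fderiv g y b) x v + (fderiv w x v \<bullet> b) *\<^sub>R fderiv g x b)) (at x)"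
    using fderiv_expand[OF Cinf_onD(1)[OF assms(3)], symmetric] by blast
  from fderiv_eqI[OF this, of v]
  have 1: "fderiv (\<lambda>y. fderiv g y (w y)) x v = (\<Sum>b\<in>Basis. (w x \<bullet> b) *\<^sub>R fderiv (\<lambda>y. fderiv g y b) x v) +
      (\<Sum>b\<in>Basis. (fderiv w x v \<bullet> b) *\<^sub>R fderiv g x b)"
    by (simp only: sum.distrib)
  have "((\<lambda>y. \<Sum>b\<in>Basis. (w x \<bullet> b) *\<^sub>R fderiv g y b) has_derivative
      (\<lambda>v. \<Sum>b\<in>Basis. (w x \<bullet> b) *\<^sub>R fderiv (\<lambda>y. fderiv g y b) x v)) (at x)"
    by (rule has_derivative_sum, rule has_derivative_scaleR_right[OF dg])
  from has_derivative_transform_within_open[OF this assms(1,2), of "\<lambda>y. fderiv g y (w x)"]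
  have "((\<lambda>y. fderiv g y (w x)) has_derivative
      (\<lambda>v. \<Sum>b\<in>Basis. (w x \<bullet> b) *\<^sub>R fderiv (\<lambda>y. fderiv g y b) x v)) (at x)"
    using fderiv_expand[OF Cinf_onD(1)[OF assms(3)], symmetric] by blast
  from fderiv_eqI[OF this, of v] 1 fderiv_expand[OF Cinf_onD(1)[OF assms(3,2)], of "fderiv w x v"]
  show ?thesis by simp
qed

section \<open>Charts, tangent vectors and fields along a map\<close>

text \<open>The tangent vector at \<open>p\<close> whose components in the chart \<open>c\<close> are \<open>w\<close>: the inverse of
  \<open>comps A c p\<close>.\<close>

definition coord_vec :: "('m, 'e::euclidean_space) chart set \<Rightarrow> ('m, 'e) chart \<Rightarrow> 'm \<Rightarrow> 'e \<Rightarrow> 'e" where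
  "coord_vec A c p w = fderiv (\<lambda>x. snd (chart_at A p) (param c x)) (snd c p) w"

section \<open>Functions and tangent vectors on a single manifold\<close>

locale manifold =
  fixes A :: "('m::{t2_space, second_countable_topology}, 'e::euclidean_space) chart set"
  assumes atlas: "smooth_atlas A"
begin

lemma chart_props:
  assumes "c \<in> A"
  shows "open (fst c)" "open (snd c ` fst c)" "homeomorphism (fst c) (snd c ` fst c) (snd c) (param c)"
  using atlas assms by (auto simp: smooth_atlas_def is_chart_def)

lemma param_chart: "c \<in> A \<Longrightarrow> p \<in> fst c \<Longrightarrow> param c (snd c p) = p"
  by (rule homeomorphism_apply1[OF chart_props(3)])

lemma chart_param: "c \<in> A \<Longrightarrow> x \<in> snd c ` fst c \<Longrightarrow> snd c (param c x) = x"
  by (rule homeomorphism_apply2[OF chart_props(3)])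

lemma open_chart_image:
  assumes "c \<in> A" "open U" "U \<subseteq> fst c"
  shows "open (snd c ` U)"
proof -
  have "openin (top_of_set (fst c)) U"
    using assms chart_props(1) by (simp add: openin_open_eq)
  from homeomorphism_imp_open_map[OF chart_props(3)[OF assms(1)] this]
  show ?thesis using chart_props(2)[OF assms(1)] by (simp add: openin_open_eq)
qed

lemma chart_at: "chart_at A p \<in> A" "p \<in> fst (chart_at A p)"
proof -
  have "p \<in> (\<Union>c\<in>A. fst c)" using atlas by (simp add: smooth_atlas_def)
  then have "\<exists>c. c \<in> A \<and> p \<in> fst c" by blast
  from someI_ex[OF this] show "chart_at A p \<in> A" "p \<in> fst (chart_at A p)"
    unfolding chart_at_def by auto
qed

lemma transition_Cinf:
  assumes "c \<in> A" "d \<in> A"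
  shows "Cinf_on (snd c ` (fst c \<inter> fst d)) (\<lambda>x. snd d (param c x))"
  using atlas assms by (auto simp: smooth_atlas_def comp_def)

lemma transition_differentiable:
  assumes "c \<in> A" "d \<in> A" "p \<in> fst c" "p \<in> fst d"
  shows "(\<lambda>x. snd d (param c x)) differentiable at (snd c p)"
  using Cinf_onD(1)[OF transition_Cinf[OF assms(1,2)]] assms by auto

lemma smooth_funD:
  "smooth_fun A U h \<Longrightarrow> c \<in> A \<Longrightarrow> Cinf_on (snd c ` (U \<inter> fst c)) (\<lambda>x. h (param c x))"
  by (simp add: smooth_fun_def comp_def)

lemma smooth_fun_subset: "smooth_fun A U h \<Longrightarrow> T \<subseteq> U \<Longrightarrow> smooth_fun A T h"
  unfolding smooth_fun_def by (blast intro: Cinf_on_subset)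

lemma smooth_fun_differentiable:
  assumes "smooth_fun A U h" "p \<in> U" "c \<in> A" "p \<in> fst c"
  shows "(\<lambda>x. h (param c x)) differentiable at (snd c p)"
  using Cinf_onD(1)[OF smooth_funD[OF assms(1,3)]] assms by auto

text \<open>Smooth transition maps make one chart around each point enough, whereas the definition
  of \<open>smooth_fun\<close> asks for all charts.\<close>

lemma smooth_funI:
  assumes "\<And>p. p \<in> U \<Longrightarrow> \<exists>c\<in>A. \<exists>T. open T \<and> p \<in> T \<and> T \<subseteq> fst c \<and> Cinf_on (snd c ` T) (\<lambda>x. h (param c x))"
  shows "smooth_fun A U h"
  unfolding smooth_fun_def comp_def
proof (intro ballI Cinf_on_Union)
  fix d x assume d: "d \<in> A" and "x \<in> snd d ` (U \<inter> fst d)"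
  then obtain p where p: "p \<in> U" "p \<in> fst d" "x = snd d p" by auto
  obtain c T where c: "c \<in> A" "open T" "p \<in> T" "T \<subseteq> fst c" "Cinf_on (snd c ` T) (\<lambda>x. h (param c x))"
    using assms[OF p(1)] by blast
  let ?T = "T \<inter> fst d"
  have o: "open (snd d ` ?T)" "open (snd c ` T)"
    using c chart_props(1)[OF d] by (auto intro: open_chart_image[OF d] open_chart_image[OF c(1)])
  have 1: "Cinf_on (snd d ` ?T) (\<lambda>x. snd c (param d x))"
    by (rule Cinf_on_subset[OF transition_Cinf[OF d c(1)]]) (use c in auto)
  have 2: "(\<lambda>x. snd c (param d x)) ` (snd d ` ?T) \<subseteq> snd c ` T"
    using param_chart[OF d] by auto
  have 3: "Cinf_on (snd d ` ?T) (\<lambda>x. h (param c (snd c (param d x))))"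
    by (rule Cinf_on_compose[OF o 2 1 c(5)])
  have eq: "h (param c (snd c (param d x))) = h (param d x)" if "x \<in> snd d ` ?T" for x
  proof -
    from that obtain q where q: "q \<in> ?T" "x = snd d q" by blast
    then have "param d x = q" "q \<in> fst c" using param_chart[OF d] c(4) by auto
    then show ?thesis using param_chart[OF c(1)] by simp
  qed
  have "Cinf_on (snd d ` ?T) (\<lambda>x. h (param d x))"
    by (rule Cinf_on_cong[OF o(1) eq 3])
  then show "\<exists>T. open T \<and> x \<in> T \<and> Cinf_on T (\<lambda>x. h (param d x))"
    using o(1) p c(3) by blast
qed

lemma smooth_fun_Union:
  assumes "\<And>p. p \<in> U \<Longrightarrow> \<exists>T. open T \<and> p \<in> T \<and> smooth_fun A T h"
  shows "smooth_fun A U h"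
proof (rule smooth_funI)
  fix p assume "p \<in> U"
  then obtain T where T: "open T" "p \<in> T" "smooth_fun A T h" using assms by blast
  let ?c = "chart_at A p"
  have "Cinf_on (snd ?c ` (T \<inter> fst ?c)) (\<lambda>x. h (param ?c x))"
    by (rule smooth_funD[OF T(3) chart_at(1)])
  then show "\<exists>c\<in>A. \<exists>T. open T \<and> p \<in> T \<and> T \<subseteq> fst c \<and> Cinf_on (snd c ` T) (\<lambda>x. h (param c x))"
    using T(1,2) chart_at[of p] chart_props(1)[OF chart_at(1)]
    by (intro bexI[of _ ?c] exI[of _ "T \<inter> fst ?c"]) auto
qed

lemma open_chart_Int: "open U \<Longrightarrow> c \<in> A \<Longrightarrow> open (snd c ` (U \<inter> fst c))"
  by (rule open_chart_image[OF _ open_Int[OF _ chart_props(1)]]) auto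

lemma smooth_fun_cong:
  assumes "open U" "\<And>p. p \<in> U \<Longrightarrow> h p = k p" "smooth_fun A U h"
  shows "smooth_fun A U k"
  unfolding smooth_fun_def comp_def
proof
  fix c assume c: "c \<in> A"
  show "Cinf_on (snd c ` (U \<inter> fst c)) (\<lambda>x. k (param c x))"
    by (rule Cinf_on_cong[OF open_chart_Int[OF assms(1) c] _ smooth_funD[OF assms(3) c]])
      (use assms(2) param_chart[OF c] in auto)
qed

lemma smooth_fun_const: "smooth_fun A U (\<lambda>p. k)"
  by (simp add: smooth_fun_def comp_def Cinf_on_const)

lemma smooth_fun_add:
  "open U \<Longrightarrow> smooth_fun A U h \<Longrightarrow> smooth_fun A U k \<Longrightarrow> smooth_fun A U (\<lambda>p. h p + k p)"
  using open_chart_Int by (auto simp: smooth_fun_def comp_def intro: Cinf_on_add)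

lemma smooth_fun_scaleR:
  "open U \<Longrightarrow> smooth_fun A U h \<Longrightarrow> smooth_fun A U k \<Longrightarrow> smooth_fun A U (\<lambda>p. h p *\<^sub>R k p)"
  using open_chart_Int by (auto simp: smooth_fun_def comp_def intro: Cinf_on_scaleR)

lemma smooth_fun_bounded_linear:
  "open U \<Longrightarrow> smooth_fun A U h \<Longrightarrow> bounded_linear L \<Longrightarrow> smooth_fun A U (\<lambda>p. L (h p))"
  using open_chart_Int by (auto simp: smooth_fun_def comp_def intro: Cinf_on_bounded_linear)

lemma smooth_fun_inner:
  "open U \<Longrightarrow> smooth_fun A U h \<Longrightarrow> smooth_fun A U (\<lambda>p. h p \<bullet> b)"
  by (rule smooth_fun_bounded_linear[OF _ _ bounded_linear_inner_left])

lemma smooth_fun_inverse: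
  fixes h :: "'m \<Rightarrow> real"
  assumes "open U" "smooth_fun A U h" "\<And>p. p \<in> U \<Longrightarrow> h p \<noteq> 0"
  shows "smooth_fun A U (\<lambda>p. inverse (h p))"
  unfolding smooth_fun_def comp_def
proof
  fix c assume c: "c \<in> A"
  show "Cinf_on (snd c ` (U \<inter> fst c)) (\<lambda>x. inverse (h (param c x)))"
    by (rule Cinf_on_inverse[OF open_chart_Int[OF assms(1) c] smooth_funD[OF assms(2) c]])
      (use assms(3) param_chart[OF c] in auto)
qed

lemma smooth_fun_sum:
  "open U \<Longrightarrow> (\<And>i. i \<in> I \<Longrightarrow> smooth_fun A U (h i)) \<Longrightarrow> smooth_fun A U (\<lambda>p. \<Sum>i\<in>I. h i p)"
  by (induction I rule: infinite_finite_induct) (auto intro: smooth_fun_add smooth_fun_const)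

lemma smooth_fun_compose:
  fixes h :: "'m \<Rightarrow> 'b::euclidean_space"
  assumes "open U" "open T" "h ` U \<subseteq> T" "smooth_fun A U h" "Cinf_on T g"
  shows "smooth_fun A U (\<lambda>p. g (h p))"
  unfolding smooth_fun_def comp_def
proof
  fix c assume c: "c \<in> A"
  show "Cinf_on (snd c ` (U \<inter> fst c)) (\<lambda>x. g (h (param c x)))"
    by (rule Cinf_on_compose[OF open_chart_Int[OF assms(1) c] assms(2) _ smooth_funD[OF assms(4) c] assms(5)])
      (use assms(3) param_chart[OF c] in auto)
qed

lemma smooth_fun_fderiv:
  fixes h :: "'m \<Rightarrow> 'b::euclidean_space"
  assumes "open U" "open T" "h ` U \<subseteq> T" "smooth_fun A U h" "Cinf_on T g" "smooth_fun A U w"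
  shows "smooth_fun A U (\<lambda>p. fderiv g (h p) (w p))"
  unfolding smooth_fun_def comp_def
proof
  fix c assume c: "c \<in> A"
  show "Cinf_on (snd c ` (U \<inter> fst c)) (\<lambda>x. fderiv g (h (param c x)) (w (param c x)))"
    by (rule Cinf_on_fderiv[OF open_chart_Int[OF assms(1) c] assms(2) _ smooth_funD[OF assms(4) c]
          assms(5) smooth_funD[OF assms(6) c]])
      (use assms(3) param_chart[OF c] in auto)
qed

lemma smooth_fun_chart:
  assumes "c \<in> A"
  shows "smooth_fun A (fst c) (snd c)"
  unfolding smooth_fun_def comp_def using transition_Cinf[OF _ assms] by (simp add: Int_commute)

lemma dir_deriv_has_derivative:
  assumes "smooth_fun A U h" "p \<in> U"
  shows "((\<lambda>x. h (param (chart_at A p) x)) has_derivative dir_deriv A h p) (at (snd (chart_at A p) p))"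
proof -
  have "dir_deriv A h p = fderiv (\<lambda>x. h (param (chart_at A p) x)) (snd (chart_at A p) p)"
    by (simp add: fun_eq_iff dir_deriv_def comp_def)
  then show ?thesis
    using has_derivative_fderiv[OF smooth_fun_differentiable[OF assms chart_at]] by simp
qed

lemma dir_derivI:
  assumes "((\<lambda>x. h (param (chart_at A p) x)) has_derivative D) (at (snd (chart_at A p) p))"
  shows "dir_deriv A h p v = D v"
  using fderiv_eqI[OF assms] by (simp add: dir_deriv_def comp_def)

lemma dir_deriv_linear:
  assumes "smooth_fun A U h" "p \<in> U"
  shows "linear (dir_deriv A h p)"
  using dir_deriv_has_derivative[OF assms] has_derivative_linear by blast

lemma dir_deriv_cong:
  assumes "open U" "p \<in> U" "\<And>q. q \<in> U \<Longrightarrow> h q = k q" "smooth_fun A U h"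
  shows "dir_deriv A h p v = dir_deriv A k p v"
proof -
  let ?c = "chart_at A p"
  have "((\<lambda>x. k (param ?c x)) has_derivative dir_deriv A h p) (at (snd ?c p))"
    by (rule has_derivative_transform_within_open[OF dir_deriv_has_derivative[OF assms(4,2)]
          open_chart_Int[OF assms(1) chart_at(1)[of p]]])
      (use assms(2,3) chart_at[of p] param_chart[OF chart_at(1)] in auto)
  from dir_derivI[OF this] show ?thesis by simp
qed

lemma dir_deriv_const: "dir_deriv A (\<lambda>q. k) p v = 0"
  by (rule dir_derivI) (rule has_derivative_const)

lemma dir_deriv_scaleR:
  assumes "smooth_fun A U h" "smooth_fun A U k" "p \<in> U"
  shows "dir_deriv A (\<lambda>q. h q *\<^sub>R k q) p v = dir_deriv A h p v *\<^sub>R k p + h p *\<^sub>R dir_deriv A k p v"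
  using dir_derivI[OF has_derivative_scaleR[OF dir_deriv_has_derivative[OF assms(1,3)]
        dir_deriv_has_derivative[OF assms(2,3)]], of v] param_chart[OF chart_at]
  by simp

lemma dir_deriv_sum:
  assumes "\<And>i. i \<in> I \<Longrightarrow> smooth_fun A U (h i)" "p \<in> U"
  shows "dir_deriv A (\<lambda>q. \<Sum>i\<in>I. h i q) p v = (\<Sum>i\<in>I. dir_deriv A (h i) p v)"
  by (rule dir_derivI, rule has_derivative_sum) (rule dir_deriv_has_derivative[OF assms])

lemma dir_deriv_inner:
  assumes "smooth_fun A U h" "p \<in> U"
  shows "dir_deriv A (\<lambda>q. h q \<bullet> b) p v = dir_deriv A h p v \<bullet> b"
  by (rule dir_derivI, rule bounded_linear.has_derivative[OF bounded_linear_inner_left])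
    (rule dir_deriv_has_derivative[OF assms])

lemma dir_deriv_compose:
  assumes "smooth_fun A U h" "p \<in> U" "g differentiable at (h p)"
  shows "dir_deriv A (\<lambda>q. g (h q)) p v = fderiv g (h p) (dir_deriv A h p v)"
  by (rule dir_derivI, rule has_derivative_compose[OF dir_deriv_has_derivative[OF assms(1,2)]])
    (use assms(3) param_chart[OF chart_at] in \<open>simp add: frechet_derivative_works\<close>)

text \<open>By the chain rule for the change of charts, a directional derivative may be computed in
  any chart once the vector is replaced by its components there. Only such a formula, with
  \<open>c\<close> fixed, can show how the derivative depends on \<open>p\<close>, since the
  preferred chart in \<open>dir_deriv\<close> jumps.\<close>

lemma dir_deriv_chart:
  assumes c: "c \<in> A" "p \<in> fst c" and h: "(\<lambda>x. h (param c x)) differentiable at (snd c p)"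
  shows "dir_deriv A h p v = fderiv (\<lambda>x. h (param c x)) (snd c p) (comps A c p v)"
proof -
  let ?C = "chart_at A p"
  have pc: "param ?C (snd ?C p) = p" by (rule param_chart[OF chart_at])
  have o: "open (snd ?C ` (fst c \<inter> fst ?C))"
    by (rule open_chart_Int[OF chart_props(1)[OF c(1)] chart_at(1)])
  have "((\<lambda>x. h (param c (snd c (param ?C x)))) has_derivative
      (\<lambda>v. fderiv (\<lambda>x. h (param c x)) (snd c p) (comps A c p v))) (at (snd ?C p))"
    using has_derivative_compose[OF dir_deriv_has_derivative[OF smooth_fun_chart[OF c(1)] c(2)], of "\<lambda>x. h (param c x)"]
      has_derivative_fderiv[OF h] pc
    unfolding comps_def by simp
  then have "((\<lambda>x. h (param ?C x)) has_derivative
      (\<lambda>v. fderiv (\<lambda>x. h (param c x)) (snd c p) (comps A c p v))) (at (snd ?C p))"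
    by (rule has_derivative_transform_within_open[OF _ o])
      (use c chart_at[of p] param_chart[OF chart_at(1)] param_chart[OF c(1)] in auto)
  from dir_derivI[OF this] show ?thesis by simp
qed

lemma comps_linear: "c \<in> A \<Longrightarrow> p \<in> fst c \<Longrightarrow> linear (comps A c p)"
  unfolding comps_def by (rule dir_deriv_linear[OF smooth_fun_chart])

lemma comps_change:
  assumes "c \<in> A" "d \<in> A" "p \<in> fst c" "p \<in> fst d"
  shows "comps A d p v = fderiv (\<lambda>x. snd d (param c x)) (snd c p) (comps A c p v)"
  unfolding comps_def[of A d]
  by (rule dir_deriv_chart[OF assms(1,3) transition_differentiable[OF assms]])

lemma fderiv_chart_param:
  assumes "c \<in> A" "p \<in> fst c"
  shows "fderiv (\<lambda>x. snd c (param c x)) (snd c p) v = v"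
proof -
  have "((\<lambda>x. snd c (param c x)) has_derivative (\<lambda>v. v)) (at (snd c p))"
    by (rule has_derivative_transform_within_open[OF has_derivative_ident chart_props(2)[OF assms(1)]])
      (use assms chart_param in auto)
  from fderiv_eqI[OF this] show ?thesis .
qed

lemma comps_self: "comps A (chart_at A p) p v = v"
  unfolding comps_def dir_deriv_def comp_def by (rule fderiv_chart_param[OF chart_at])

text \<open>A vector equals its own components in the preferred chart, so this is the change of
  components from \<open>c\<close> to that chart.\<close>

lemma coord_vec_comps: "c \<in> A \<Longrightarrow> p \<in> fst c \<Longrightarrow> coord_vec A c p (comps A c p v) = v"
  using comps_change[OF _ chart_at(1) _ chart_at(2), of c p v] by (simp add: coord_vec_def comps_self)

text \<open>The transition maps between \<open>c\<close> and the preferred chart are inverse to each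
  other near the point, hence so are their derivatives.\<close>

lemma comps_coord_vec:
  assumes "c \<in> A" "p \<in> fst c"
  shows "comps A c p (coord_vec A c p w) = w"
proof -
  let ?C = "chart_at A p"
  let ?T = "\<lambda>x. snd ?C (param c x)" and ?S = "\<lambda>x. snd c (param ?C x)"
  have pc: "?T (snd c p) = snd ?C p" using param_chart[OF assms] by simp
  have T: "?T differentiable at (snd c p)" "?S differentiable at (?T (snd c p))"
    unfolding pc by (rule transition_differentiable; use assms chart_at in auto)+
  have "comps A c p (coord_vec A c p w) = fderiv ?S (?T (snd c p)) (fderiv ?T (snd c p) w)"
    unfolding pc by (simp add: comps_def dir_deriv_def comp_def coord_vec_def)
  also have "\<dots> = fderiv (\<lambda>x. ?S (?T x)) (snd c p) w"
    by (rule fderiv_compose(2)[OF T, symmetric])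
  also have "\<dots> = fderiv (\<lambda>x. x) (snd c p) w"
  proof (rule fderiv_cong(2))
    show "open (snd c ` (fst ?C \<inter> fst c))"
      by (rule open_chart_Int[OF chart_props(1)[OF chart_at(1)] assms(1)])
    show "snd c p \<in> snd c ` (fst ?C \<inter> fst c)" using assms chart_at by auto
    show "x = ?S (?T x)" if "x \<in> snd c ` (fst ?C \<inter> fst c)" for x
      using that param_chart[OF assms(1)] param_chart[OF chart_at(1)] by auto
  qed auto
  also have "\<dots> = w" by simp
  finally show ?thesis .
qed

lemma coord_vec_linear: "c \<in> A \<Longrightarrow> p \<in> fst c \<Longrightarrow> linear (coord_vec A c p)"
  using linear_frechet_derivative[OF transition_differentiable[OF _ chart_at(1) _ chart_at(2)]]
  unfolding coord_vec_def by blast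

lemma smooth_fieldD:
  "smooth_field A U X \<Longrightarrow> c \<in> A \<Longrightarrow> smooth_fun A (U \<inter> fst c) (\<lambda>q. comps A c q (X q))"
  by (simp add: smooth_field_def smooth_along_def)

text \<open>Near \<open>p\<close> all derivatives are rewritten in the preferred chart of the single
  point \<open>p\<close>, where they depend smoothly on the base point and on the components of
  \<open>X\<close>.\<close>

lemma smooth_fun_dir_deriv:
  assumes "open U" "smooth_fun A U h" "smooth_field A U X"
  shows "smooth_fun A U (\<lambda>q. dir_deriv A h q (X q))"
proof (rule smooth_fun_Union)
  fix p assume p: "p \<in> U"
  let ?c = "chart_at A p"
  let ?T = "U \<inter> fst ?c"
  have o: "open ?T" using assms(1) chart_props(1)[OF chart_at(1)] by blast
  have o': "open (snd ?c ` ?T)" by (rule open_chart_Int[OF assms(1) chart_at(1)])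
  have "smooth_fun A ?T (\<lambda>q. fderiv (\<lambda>x. h (param ?c x)) (snd ?c q) (comps A ?c q (X q)))"
    by (rule smooth_fun_fderiv[OF o o' subset_refl smooth_fun_subset[OF smooth_fun_chart[OF chart_at(1)]]
          smooth_funD[OF assms(2) chart_at(1)] smooth_fieldD[OF assms(3) chart_at(1)]]) auto
  then have "smooth_fun A ?T (\<lambda>q. dir_deriv A h q (X q))"
    by (rule smooth_fun_cong[OF o, rotated])
      (rule dir_deriv_chart[symmetric]; use smooth_fun_differentiable[OF assms(2)] chart_at(1) in auto)
  then show "\<exists>T. open T \<and> p \<in> T \<and> smooth_fun A T (\<lambda>q. dir_deriv A h q (X q))"
    using o p chart_at(2) by blast
qed

end

section \<open>Smooth maps and vector fields along them\<close>

locale manifold_map = A: manifold A + B: manifold B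
  for A :: "('m::{t2_space, second_countable_topology}, 'd::euclidean_space) chart set"
    and B :: "('n::{t2_space, second_countable_topology}, 'e::euclidean_space) chart set" +
  fixes f :: "'m \<Rightarrow> 'n"
  assumes smooth_map: "smooth_map A B f"
begin

lemma open_vimage: "open V \<Longrightarrow> open (f -` V)"
  using smooth_map by (auto simp: smooth_map_def intro: open_vimage)

lemma open_vimage_chart: "d \<in> B \<Longrightarrow> open (f -` fst d)"
  by (rule open_vimage[OF B.chart_props(1)])

lemma smooth_fun_coord: "d \<in> B \<Longrightarrow> smooth_fun A (f -` fst d) (\<lambda>q. snd d (f q))"
  using smooth_map by (simp add: smooth_map_def comp_def)

lemma chart_at_image:
  assumes "open U" "p \<in> U"
  shows "open (U \<inter> f -` fst (chart_at B (f p)))" "p \<in> U \<inter> f -` fst (chart_at B (f p))"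
  using assms open_vimage_chart[OF B.chart_at(1)] B.chart_at(2) by auto

lemma smooth_fun_comp:
  assumes "open V" "smooth_fun B V G"
  shows "smooth_fun A (f -` V) (\<lambda>q. G (f q))"
proof (rule A.smooth_fun_Union)
  fix p assume p: "p \<in> f -` V"
  let ?d = "chart_at B (f p)"
  let ?T = "f -` V \<inter> f -` fst ?d"
  have o: "open ?T" "p \<in> ?T" using chart_at_image[OF open_vimage[OF assms(1)] p] .
  have "smooth_fun A ?T (\<lambda>q. G (param ?d (snd ?d (f q))))"
    by (rule A.smooth_fun_compose[OF o(1) B.open_chart_Int[OF assms(1) B.chart_at(1)] _
          A.smooth_fun_subset[OF smooth_fun_coord[OF B.chart_at(1)]] B.smooth_funD[OF assms(2) B.chart_at(1)]])
      auto
  then have "smooth_fun A ?T (\<lambda>q. G (f q))"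
    by (rule A.smooth_fun_cong[OF o(1), rotated]) (simp add: B.param_chart[OF B.chart_at(1)])
  then show "\<exists>T. open T \<and> p \<in> T \<and> smooth_fun A T (\<lambda>q. G (f q))" using o by blast
qed

lemma dir_deriv_comp:
  assumes "open V" "smooth_fun B V G" "f p \<in> V"
  shows "dir_deriv A (\<lambda>q. G (f q)) p v = dir_deriv B G (f p) (differential A B f p v)"
proof -
  let ?d = "chart_at B (f p)"
  let ?T = "f -` V \<inter> f -` fst ?d"
  have o: "open ?T" "p \<in> ?T" using chart_at_image[OF open_vimage[OF assms(1)]] assms(3) by auto
  have s: "smooth_fun A ?T (\<lambda>q. snd ?d (f q))"
    by (rule A.smooth_fun_subset[OF smooth_fun_coord[OF B.chart_at(1)]]) auto
  have "dir_deriv A (\<lambda>q. G (f q)) p v = dir_deriv A (\<lambda>q. G (param ?d (snd ?d (f q)))) p v"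
    by (rule A.dir_deriv_cong[OF o _ A.smooth_fun_subset[OF smooth_fun_comp[OF assms(1,2)]]])
      (auto simp: B.param_chart[OF B.chart_at(1)])
  also have "\<dots> = fderiv (\<lambda>x. G (param ?d x)) (snd ?d (f p)) (dir_deriv A (\<lambda>q. snd ?d (f q)) p v)"
    by (rule A.dir_deriv_compose[OF s o(2) B.smooth_fun_differentiable[OF assms(2,3) B.chart_at]])
  also have "\<dots> = dir_deriv B G (f p) (differential A B f p v)"
    by (simp add: dir_deriv_def[of B] differential_def comp_def)
  finally show ?thesis .
qed

lemma comps_differential:
  "d \<in> B \<Longrightarrow> f p \<in> fst d \<Longrightarrow> comps B d (f p) (differential A B f p v) = dir_deriv A (\<lambda>q. snd d (f q)) p v"
  unfolding comps_def using dir_deriv_comp[OF B.chart_props(1) B.smooth_fun_chart] by simp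

lemma differential_linear: "linear (differential A B f p)"
  unfolding differential_def comp_def
  by (rule A.dir_deriv_linear[OF smooth_fun_coord[OF B.chart_at(1)]]) (simp add: B.chart_at(2))

lemma smooth_alongD:
  "smooth_along A B f U W \<Longrightarrow> d \<in> B \<Longrightarrow> smooth_fun A (U \<inter> f -` fst d) (\<lambda>q. comps B d (f q) (W q))"
  by (simp add: smooth_along_def)

text \<open>One chart of the target suffices near each point: the components in another chart arise
  by applying the Jacobian of the transition map, which varies smoothly along
  \<open>f\<close>.\<close>

lemma smooth_alongI:
  assumes "\<And>p. p \<in> U \<Longrightarrow> \<exists>d\<in>B. \<exists>T. open T \<and> p \<in> T \<and> T \<subseteq> f -` fst d \<and> smooth_fun A T (\<lambda>q. comps B d (f q) (W q))"
  shows "smooth_along A B f U W"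
  unfolding smooth_along_def
proof (intro ballI A.smooth_fun_Union)
  fix d p assume d: "d \<in> B" and p: "p \<in> U \<inter> f -` fst d"
  obtain c T where c: "c \<in> B" "open T" "p \<in> T" "T \<subseteq> f -` fst c" "smooth_fun A T (\<lambda>q. comps B c (f q) (W q))"
    using assms p by blast
  let ?T = "T \<inter> f -` fst d"
  have o: "open ?T" using c(2) open_vimage_chart[OF d] by blast
  have o': "open (snd c ` (fst c \<inter> fst d))"
    by (rule B.open_chart_image[OF c(1) open_Int[OF B.chart_props(1)[OF c(1)] B.chart_props(1)[OF d]]]) auto
  have "smooth_fun A ?T (\<lambda>q. fderiv (\<lambda>x. snd d (param c x)) (snd c (f q)) (comps B c (f q) (W q)))"
    by (rule A.smooth_fun_fderiv[OF o o' _ A.smooth_fun_subset[OF smooth_fun_coord[OF c(1)]]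
          B.transition_Cinf[OF c(1) d] A.smooth_fun_subset[OF c(5)]]) (use c(4) in auto)
  then have "smooth_fun A ?T (\<lambda>q. comps B d (f q) (W q))"
    by (rule A.smooth_fun_cong[OF o, rotated])
      (rule B.comps_change[symmetric]; use c(1,4) d in auto)
  then show "\<exists>T. open T \<and> p \<in> T \<and> smooth_fun A T (\<lambda>q. comps B d (f q) (W q))"
    using o p c(3) by blast
qed

lemma smooth_along_subset: "smooth_along A B f U W \<Longrightarrow> T \<subseteq> U \<Longrightarrow> smooth_along A B f T W"
  unfolding smooth_along_def by (meson A.smooth_fun_subset Int_mono subset_refl)

lemma smooth_along_Union:
  assumes "\<And>p. p \<in> U \<Longrightarrow> \<exists>T. open T \<and> p \<in> T \<and> smooth_along A B f T W"
  shows "smooth_along A B f U W"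
proof (rule smooth_alongI)
  fix p assume "p \<in> U"
  then obtain T where T: "open T" "p \<in> T" "smooth_along A B f T W" using assms by blast
  show "\<exists>d\<in>B. \<exists>T. open T \<and> p \<in> T \<and> T \<subseteq> f -` fst d \<and> smooth_fun A T (\<lambda>q. comps B d (f q) (W q))"
    using chart_at_image[OF T(1,2)] smooth_alongD[OF T(3) B.chart_at(1)] B.chart_at(1)
    by (intro bexI[of _ "chart_at B (f p)"] exI[of _ "T \<inter> f -` fst (chart_at B (f p))"]) auto
qed

lemma smooth_along_cong:
  assumes "open U" "\<And>q. q \<in> U \<Longrightarrow> W q = W' q" "smooth_along A B f U W"
  shows "smooth_along A B f U W'"
  unfolding smooth_along_def
proof
  fix d assume d: "d \<in> B"
  show "smooth_fun A (U \<inter> f -` fst d) (\<lambda>q. comps B d (f q) (W' q))"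
    by (rule A.smooth_fun_cong[OF _ _ smooth_alongD[OF assms(3) d]])
      (use assms(1,2) open_vimage_chart[OF d] in auto)
qed

lemma smooth_along_add:
  assumes "open U" "smooth_along A B f U W" "smooth_along A B f U W'"
  shows "smooth_along A B f U (\<lambda>q. W q + W' q)"
  unfolding smooth_along_def
proof
  fix d assume d: "d \<in> B"
  have o: "open (U \<inter> f -` fst d)" using assms(1) open_vimage_chart[OF d] by blast
  show "smooth_fun A (U \<inter> f -` fst d) (\<lambda>q. comps B d (f q) (W q + W' q))"
    by (rule A.smooth_fun_cong[OF o _ A.smooth_fun_add[OF o smooth_alongD[OF assms(2) d] smooth_alongD[OF assms(3) d]]])
      (use B.comps_linear[OF d] in \<open>simp add: linear_add\<close>)
qed

lemma smooth_along_scaleR: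
  assumes "open U" "smooth_fun A U h" "smooth_along A B f U W"
  shows "smooth_along A B f U (\<lambda>q. h q *\<^sub>R W q)"
  unfolding smooth_along_def
proof
  fix d assume d: "d \<in> B"
  have o: "open (U \<inter> f -` fst d)" using assms(1) open_vimage_chart[OF d] by blast
  show "smooth_fun A (U \<inter> f -` fst d) (\<lambda>q. comps B d (f q) (h q *\<^sub>R W q))"
    by (rule A.smooth_fun_cong[OF o _ A.smooth_fun_scaleR[OF o A.smooth_fun_subset[OF assms(2) Int_lower1]
            smooth_alongD[OF assms(3) d]]])
      (use B.comps_linear[OF d] in \<open>simp add: linear_scale\<close>)
qed

lemma smooth_along_zero: "open U \<Longrightarrow> smooth_along A B f U (\<lambda>q. 0)"
  unfolding smooth_along_def
proof
  fix d assume "open U" and d: "d \<in> B"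
  then have o: "open (U \<inter> f -` fst d)" using open_vimage_chart[OF d] by blast
  show "smooth_fun A (U \<inter> f -` fst d) (\<lambda>q. comps B d (f q) 0)"
    by (rule A.smooth_fun_cong[OF o _ A.smooth_fun_const[of _ 0]])
      (use B.comps_linear[OF d] in \<open>simp add: linear_0\<close>)
qed

lemma smooth_along_minus:
  assumes "open U" "smooth_along A B f U W"
  shows "smooth_along A B f U (\<lambda>q. - W q)"
  using smooth_along_scaleR[OF assms(1) A.smooth_fun_const[of _ "-1"] assms(2)] by simp

lemma smooth_along_diff:
  assumes "open U" "smooth_along A B f U W" "smooth_along A B f U W'"
  shows "smooth_along A B f U (\<lambda>q. W q - W' q)"
  using smooth_along_add[OF assms(1,2) smooth_along_minus[OF assms(1,3)]] by simp

lemma smooth_along_sum: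
  "open U \<Longrightarrow> (\<And>i. i \<in> I \<Longrightarrow> smooth_along A B f U (W i)) \<Longrightarrow> smooth_along A B f U (\<lambda>q. \<Sum>i\<in>I. W i q)"
  by (induction I rule: infinite_finite_induct) (auto intro: smooth_along_add smooth_along_zero)

lemma smooth_along_comp:
  assumes "open V" "smooth_field B V Y"
  shows "smooth_along A B f (f -` V) (\<lambda>q. Y (f q))"
  unfolding smooth_along_def
proof
  fix d assume d: "d \<in> B"
  show "smooth_fun A (f -` V \<inter> f -` fst d) (\<lambda>q. comps B d (f q) (Y (f q)))"
    using smooth_fun_comp[OF _ B.smooth_fieldD[OF assms(2) d]] assms(1) B.chart_props(1)[OF d]
    by (auto simp: vimage_Int)
qed

lemma smooth_along_differential:
  assumes "open U" "smooth_field A U X"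
  shows "smooth_along A B f U (\<lambda>q. differential A B f q (X q))"
  unfolding smooth_along_def
proof
  fix d assume d: "d \<in> B"
  have o: "open (U \<inter> f -` fst d)" using assms(1) open_vimage_chart[OF d] by blast
  have "smooth_field A (U \<inter> f -` fst d) X"
    unfolding smooth_field_def smooth_along_def
  proof
    fix c assume "c \<in> A"
    show "smooth_fun A (U \<inter> f -` fst d \<inter> id -` fst c) (\<lambda>q. comps A c (id q) (X q))"
      unfolding vimage_id id_apply
      by (rule A.smooth_fun_subset[OF A.smooth_fieldD[OF assms(2) \<open>c \<in> A\<close>]]) auto
  qed
  from A.smooth_fun_dir_deriv[OF o A.smooth_fun_subset[OF smooth_fun_coord[OF d]] this]
  have "smooth_fun A (U \<inter> f -` fst d) (\<lambda>q. dir_deriv A (\<lambda>q. snd d (f q)) q (X q))" by simp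
  then show "smooth_fun A (U \<inter> f -` fst d) (\<lambda>q. comps B d (f q) (differential A B f q (X q)))"
    by (rule A.smooth_fun_cong[OF o, rotated]) (use comps_differential[OF d] in simp)
qed

text \<open>The coefficients live on the source while the frame fields come from the target. This is
  the shape in which the Leibniz rule and the chain rule together determine a pullback
  connection.\<close>

lemma along_frame:
  assumes "d \<in> B" "f q \<in> fst d"
  shows "W q = (\<Sum>b\<in>Basis. (comps B d (f q) (W q) \<bullet> b) *\<^sub>R coord_vec B d (f q) b)"
proof -
  have "W q = coord_vec B d (f q) (\<Sum>b\<in>Basis. (comps B d (f q) (W q) \<bullet> b) *\<^sub>R b)"
    using B.coord_vec_comps[OF assms] by (simp add: euclidean_representation)
  then show ?thesis
    using B.coord_vec_linear[OF assms] by (simp add: linear_sum linear_scale)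
qed

end

text \<open>Vector fields are fields along the identity, so they inherit the closure properties just
  shown.\<close>

lemma (in manifold) manifold_map_id: "manifold_map A A id"
proof (unfold_locales)
  show "smooth_map A A id"
    using smooth_fun_chart by (simp add: smooth_map_def)
qed

context manifold
begin

interpretation id: manifold_map A A id by (rule manifold_map_id)

lemmas smooth_fieldI = id.smooth_alongI[folded smooth_field_def, unfolded vimage_id id_apply]
lemmas smooth_field_subset = id.smooth_along_subset[folded smooth_field_def]
lemmas smooth_field_Union = id.smooth_along_Union[folded smooth_field_def]
lemmas smooth_field_cong = id.smooth_along_cong[folded smooth_field_def]
lemmas smooth_field_diff = id.smooth_along_diff[folded smooth_field_def]
lemmas smooth_field_scaleR = id.smooth_along_scaleR[folded smooth_field_def]
lemmas smooth_field_sum = id.smooth_along_sum[folded smooth_field_def]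

lemma smooth_field_coord_vec:
  assumes "c \<in> A"
  shows "smooth_field A (fst c) (\<lambda>q. coord_vec A c q w)"
proof (rule smooth_fieldI)
  fix p assume "p \<in> fst c"
  have "smooth_fun A (fst c) (\<lambda>q. comps A c q (coord_vec A c q w))"
    by (rule smooth_fun_cong[OF chart_props(1)[OF assms] _ smooth_fun_const[of _ w]])
      (simp add: comps_coord_vec[OF assms])
  then show "\<exists>d\<in>A. \<exists>T. open T \<and> p \<in> T \<and> T \<subseteq> fst d \<and> smooth_fun A T (\<lambda>q. comps A d q (coord_vec A c q w))"
    using assms chart_props(1)[OF assms] \<open>p \<in> fst c\<close> by blast
qed

end


context manifold
begin

text \<open>The coordinate definition of the bracket is identified with the commutator of
  derivations. It is applied later to the coordinates of the immersion, which is why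
  \<open>h\<close> is vector-valued.\<close>

lemma dir_deriv_lie_bracket:
  fixes h :: "'m \<Rightarrow> 'b::euclidean_space"
  assumes U: "open U" "p \<in> U" and h: "smooth_fun A U h"
    and X: "smooth_field A U X" and Y: "smooth_field A U Y"
  shows "dir_deriv A (\<lambda>q. dir_deriv A h q (Y q)) p (X p) - dir_deriv A (\<lambda>q. dir_deriv A h q (X q)) p (Y p)
    = dir_deriv A h p (lie_bracket A X Y p)"
proof -
  \<comment> \<open>The preferred chart at \<open>p\<close> is the one in which
    \<open>lie_bracket\<close> is defined, and in it \<open>X p\<close> and \<open>Y p\<close> are
    their own components.\<close>
  define c where "c = chart_at A p"
  define k where "k = (\<lambda>x. h (param c x))"
  define coords where "coords = (\<lambda>X x. comps A c (param c x) (X (param c x)))"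
  let ?S = "snd c ` (U \<inter> fst c)" and ?x = "snd c p"
  have c: "c \<in> A" "p \<in> fst c" by (simp_all add: c_def chart_at)
  have S: "open ?S" "?x \<in> ?S" using open_chart_Int[OF U(1) c(1)] U c by auto
  have k: "Cinf_on ?S k" unfolding k_def by (rule smooth_funD[OF h c(1)])
  have dk: "dir_deriv A h p v = fderiv k ?x v" for v
    by (simp add: dir_deriv_def k_def c_def o_def)
  have coords: "Cinf_on ?S (coords Z)" if "smooth_field A U Z" for Z
    using smooth_funD[OF smooth_fieldD[OF that c(1)] c(1)] by (simp add: coords_def)
  have coords_p: "coords Z ?x = Z p" for Z
    using param_chart[OF c] comps_self[of p] by (simp add: coords_def c_def)
  have *: "dir_deriv A (\<lambda>q. dir_deriv A h q (Z q)) p v =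
      fderiv (\<lambda>x. fderiv k x (Z p)) ?x v + fderiv k ?x (dir_deriv A (\<lambda>q. comps A c q (Z q)) p v)"
    if Z: "smooth_field A U Z" for Z v
  proof -
    have "Cinf_on ?S (\<lambda>x. fderiv k x (coords Z x))"
      by (rule Cinf_on_fderiv[OF S(1) S(1) _ Cinf_on_ident k coords[OF Z]]) simp
    then have d: "(\<lambda>x. fderiv k x (coords Z x)) differentiable at ?x"
      using Cinf_onD(1) S(2) by blast
    have "fderiv k x (coords Z x) = dir_deriv A h (param c x) (Z (param c x))" if "x \<in> ?S" for x
    proof -
      from that obtain q where q: "q \<in> U" "q \<in> fst c" "x = snd c q" by blast
      show ?thesis
        unfolding q(3) coords_def k_def param_chart[OF c(1) q(2)]
        by (rule dir_deriv_chart[OF c(1) q(2) smooth_fun_differentiable[OF h q(1) c(1) q(2)], symmetric])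
    qed
    from fderiv_cong(2)[OF S this d, of v]
    have "dir_deriv A (\<lambda>q. dir_deriv A h q (Z q)) p v = fderiv (\<lambda>x. fderiv k x (coords Z x)) ?x v"
      unfolding dir_deriv_def[of A "\<lambda>q. dir_deriv A h q (Z q)"] c_def[symmetric]
      by (simp add: o_def)
    also have "\<dots> = fderiv (\<lambda>x. fderiv k x (coords Z ?x)) ?x v + fderiv k ?x (fderiv (coords Z) ?x v)"
      by (rule fderiv_fderiv_field[OF S k coords[OF Z]])
    also have "fderiv (coords Z) ?x v = dir_deriv A (\<lambda>q. comps A c q (Z q)) p v"
      by (simp add: dir_deriv_def coords_def c_def o_def)
    finally show ?thesis by (simp only: coords_p)
  qed
  have "linear (fderiv k ?x)"
    by (rule linear_frechet_derivative[OF Cinf_onD(1)[OF k S(2)]])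
  then show ?thesis
    using fderiv_fderiv_commute[OF S(1) k S(2), of "Y p" "X p"]
    unfolding *[OF X] *[OF Y] dk lie_bracket_def c_def[symmetric]
    by (simp add: linear_diff)
qed

end

section \<open>Pullback connections\<close>

locale pullback = manifold_map A B f
  for A :: "('m::{t2_space, second_countable_topology}, 'd::euclidean_space) chart set"
    and B :: "('n::{t2_space, second_countable_topology}, 'e::euclidean_space) chart set"
    and f :: "'m \<Rightarrow> 'n" +
  fixes nabla :: "'n \<Rightarrow> 'e \<Rightarrow> ('n \<Rightarrow> 'e) \<Rightarrow> 'e"
    and D :: "'m \<Rightarrow> 'd \<Rightarrow> ('m \<Rightarrow> 'e) \<Rightarrow> 'e"
  assumes pullback: "pullback_connection A B f nabla D"
begin

lemma connection: "connection_along A B f D"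
  using pullback by (simp add: pullback_connection_def)

lemma
  assumes "open U" "smooth_along A B f U W"
  shows D_add: "smooth_along A B f U W' \<Longrightarrow> p \<in> U \<Longrightarrow>
      D p v (\<lambda>q. W q + W' q) = D p v W + D p v W'"
    and D_scaleR: "smooth_fun A U h \<Longrightarrow> p \<in> U \<Longrightarrow>
      D p v (\<lambda>q. h q *\<^sub>R W q) = dir_deriv A h p v *\<^sub>R W p + h p *\<^sub>R D p v W"
    and D_smooth: "smooth_field A U X \<Longrightarrow> smooth_along A B f U (\<lambda>p. D p (X p) W)"
proof -
  note * = connection[unfolded connection_along_def, THEN spec, THEN spec, THEN mp, OF conjI[OF assms]]
  show "smooth_along A B f U W' \<Longrightarrow> p \<in> U \<Longrightarrow> D p v (\<lambda>q. W q + W' q) = D p v W + D p v W'"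
    by (rule *[THEN conjunct2, THEN conjunct1, THEN spec, THEN mp, THEN bspec, THEN spec])
  show "smooth_fun A U h \<Longrightarrow> p \<in> U \<Longrightarrow>
      D p v (\<lambda>q. h q *\<^sub>R W q) = dir_deriv A h p v *\<^sub>R W p + h p *\<^sub>R D p v W"
    by (rule *[THEN conjunct2, THEN conjunct2, THEN conjunct1, THEN spec, THEN mp, THEN bspec, THEN spec])
  show "smooth_field A U X \<Longrightarrow> smooth_along A B f U (\<lambda>p. D p (X p) W)"
    by (rule *[THEN conjunct2, THEN conjunct2, THEN conjunct2, THEN spec, THEN mp])
qed

lemma D_comp:
  "open V \<Longrightarrow> smooth_field B V Y \<Longrightarrow> f p \<in> V \<Longrightarrow>
    D p v (\<lambda>q. Y (f q)) = nabla (f p) (differential A B f p v) Y"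
  using pullback unfolding pullback_connection_def by blast

text \<open>A field vanishing on \<open>U\<close> is its own product with the indicator function of the complement
  of \<open>U\<close>, which is smooth on \<open>U\<close>; hence the Leibniz rule gives locality without bump functions.\<close>

lemma D_cong:
  assumes U: "open U" "p \<in> U" and W: "smooth_along A B f U W" and eq: "\<And>q. q \<in> U \<Longrightarrow> W q = W' q"
  shows "D p v W = D p v W'"
proof -
  define Z where "Z = (\<lambda>q. W' q - W q)"
  define k :: "'m \<Rightarrow> real" where "k = (\<lambda>q. if q \<in> U then 0 else 1)"
  have Z: "smooth_along A B f U Z"
    by (rule smooth_along_cong[OF U(1) _ smooth_along_zero[OF U(1)]]) (simp add: Z_def eq)
  have k: "smooth_fun A U k"
    by (rule A.smooth_fun_cong[OF U(1) _ A.smooth_fun_const[of _ 0]]) (simp add: k_def)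
  have "(\<lambda>q. k q *\<^sub>R Z q) = Z" by (auto simp: k_def Z_def eq fun_eq_iff)
  then have "D p v Z = 0"
    using D_scaleR[OF U(1) Z k U(2), of v] U(2) by (simp add: Z_def k_def eq)
  moreover have "(\<lambda>q. W q + Z q) = W'" by (simp add: Z_def)
  ultimately show ?thesis using D_add[OF U(1) W Z U(2), of v] by simp
qed

lemma D_zero: "D p v (\<lambda>q. 0) = 0"
  using D_scaleR[OF open_UNIV smooth_along_zero[OF open_UNIV] A.smooth_fun_const[of _ 0], of p v]
  by simp

lemma D_minus:
  "open U \<Longrightarrow> smooth_along A B f U W \<Longrightarrow> p \<in> U \<Longrightarrow> D p v (\<lambda>q. - W q) = - D p v W"
  using D_scaleR[OF _ _ A.smooth_fun_const[of _ "-1"], of U W p v]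
  by (simp add: A.dir_deriv_const)

lemma D_diff:
  assumes "open U" "smooth_along A B f U W" "smooth_along A B f U W'" "p \<in> U"
  shows "D p v (\<lambda>q. W q - W' q) = D p v W - D p v W'"
  using D_add[OF assms(1,2) smooth_along_minus[OF assms(1,3)] assms(4), of v]
    D_minus[OF assms(1,3,4), of v] by simp

lemma D_sum:
  assumes "open U" "p \<in> U" "finite I" "\<And>i. i \<in> I \<Longrightarrow> smooth_along A B f U (W i)"
  shows "D p v (\<lambda>q. \<Sum>i\<in>I. W i q) = (\<Sum>i\<in>I. D p v (W i))"
  using assms(3,4)
proof (induction I)
  case (insert i I)
  have "D p v (\<lambda>q. W i q + (\<Sum>i\<in>I. W i q)) = D p v (W i) + D p v (\<lambda>q. \<Sum>i\<in>I. W i q)"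
    by (rule D_add[OF assms(1) _ smooth_along_sum[OF assms(1)] assms(2)]) (use insert in auto)
  then show ?case using insert by simp
qed (simp add: D_zero)

text \<open>\<open>D\<close> does not occur on the right-hand side, so any local expansion in fields
  pulled back from the target expresses it through \<open>nabla\<close>. The \<open>Y i\<close> need
  not be a frame: the same formula serves for a coordinate frame and for its image under an
  endomorphism.\<close>

lemma D_expand:
  assumes U: "open U" "p \<in> U" and V: "open V" "U \<subseteq> f -` V" and I: "finite I"
    and a: "\<And>i. i \<in> I \<Longrightarrow> smooth_fun A U (a i)"
    and Y: "\<And>i. i \<in> I \<Longrightarrow> smooth_field B V (Y i)"
    and W: "\<And>q. q \<in> U \<Longrightarrow> W q = (\<Sum>i\<in>I. a i q *\<^sub>R Y i (f q))"
  shows "smooth_along A B f U W"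
    and "D p v W = (\<Sum>i\<in>I. dir_deriv A (a i) p v *\<^sub>R Y i (f p) +
           a i p *\<^sub>R nabla (f p) (differential A B f p v) (Y i))"
proof -
  have sY: "smooth_along A B f U (\<lambda>q. Y i (f q))" if "i \<in> I" for i
    by (rule smooth_along_subset[OF smooth_along_comp[OF V(1) Y[OF that]] V(2)])
  have saY: "smooth_along A B f U (\<lambda>q. a i q *\<^sub>R Y i (f q))" if "i \<in> I" for i
    by (rule smooth_along_scaleR[OF U(1) a[OF that] sY[OF that]])
  have s: "smooth_along A B f U (\<lambda>q. \<Sum>i\<in>I. a i q *\<^sub>R Y i (f q))"
    by (rule smooth_along_sum[OF U(1) saY])
  show "smooth_along A B f U W"
    by (rule smooth_along_cong[OF U(1) W[symmetric] s])
  have "D p v W = D p v (\<lambda>q. \<Sum>i\<in>I. a i q *\<^sub>R Y i (f q))"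
    by (rule D_cong[OF U s W[symmetric], symmetric])
  also have "\<dots> = (\<Sum>i\<in>I. D p v (\<lambda>q. a i q *\<^sub>R Y i (f q)))"
    by (rule D_sum[OF U I saY])
  also have "\<dots> = (\<Sum>i\<in>I. dir_deriv A (a i) p v *\<^sub>R Y i (f p) +
           a i p *\<^sub>R nabla (f p) (differential A B f p v) (Y i))"
  proof (rule sum.cong[OF refl])
    fix i assume i: "i \<in> I"
    show "D p v (\<lambda>q. a i q *\<^sub>R Y i (f q)) = dir_deriv A (a i) p v *\<^sub>R Y i (f p) +
           a i p *\<^sub>R nabla (f p) (differential A B f p v) (Y i)"
      using D_scaleR[OF U(1) sY[OF i] a[OF i] U(2), of v] D_comp[OF V(1) Y[OF i], of p v] U(2) V(2)
      by auto
  qed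
  finally show "D p v W = (\<Sum>i\<in>I. dir_deriv A (a i) p v *\<^sub>R Y i (f p) +
           a i p *\<^sub>R nabla (f p) (differential A B f p v) (Y i))" .
qed

text \<open>Linearity takes care of the terms with differentiated coefficients, and parallelism on
  the target of the terms with differentiated frame fields.\<close>

lemma D_endomorphism:
  assumes lin: "\<And>x. linear (\<phi> x)"
    and smooth: "\<And>V Y. open V \<Longrightarrow> smooth_field B V Y \<Longrightarrow> smooth_field B V (\<lambda>x. \<phi> x (Y x))"
    and parallel: "\<And>V Y x u. open V \<Longrightarrow> smooth_field B V Y \<Longrightarrow> x \<in> V \<Longrightarrow>
      nabla x u (\<lambda>x. \<phi> x (Y x)) = \<phi> x (nabla x u Y)"
    and U: "open U" and W: "smooth_along A B f U W"
  shows "smooth_along A B f U (\<lambda>q. \<phi> (f q) (W q))"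
    and "p \<in> U \<Longrightarrow> D p v (\<lambda>q. \<phi> (f q) (W q)) = \<phi> (f p) (D p v W)"
proof -
  have *: "\<exists>T. open T \<and> p \<in> T \<and> smooth_along A B f T (\<lambda>q. \<phi> (f q) (W q)) \<and>
      D p v (\<lambda>q. \<phi> (f q) (W q)) = \<phi> (f p) (D p v W)" if p: "p \<in> U" for p v
  proof -
    define d where "d = chart_at B (f p)"
    define T where "T = U \<inter> f -` fst d"
    define a where "a = (\<lambda>b q. comps B d (f q) (W q) \<bullet> b)"
    let ?E = "\<lambda>b x. coord_vec B d x b"
    have d: "d \<in> B" "f p \<in> fst d" by (simp_all add: d_def B.chart_at)
    have T: "open T" "p \<in> T" "T \<subseteq> f -` fst d"
      unfolding T_def using U open_vimage_chart[OF d(1)] p d(2) by auto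
    have a: "smooth_fun A T (a b)" for b
      unfolding a_def T_def by (rule A.smooth_fun_inner[OF T(1)[unfolded T_def] smooth_alongD[OF W d(1)]])
    note E = B.smooth_field_coord_vec[OF d(1)] and o = B.chart_props(1)[OF d(1)]
    \<comment> \<open>Both \<open>W\<close> and its image get the same coefficients, so the two
      expansions of \<open>D\<close> can be compared term by term.\<close>
    have W_eq: "W q = (\<Sum>b\<in>Basis. a b q *\<^sub>R ?E b (f q))" if "q \<in> T" for q
      unfolding a_def by (rule along_frame) (use that T(3) d(1) in auto)
    have \<phi>W_eq: "\<phi> (f q) (W q) = (\<Sum>b\<in>Basis. a b q *\<^sub>R \<phi> (f q) (?E b (f q)))" if "q \<in> T" for q
      by (subst W_eq[OF that]) (simp add: linear_sum[OF lin] linear_scale[OF lin])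
    have s\<phi>W: "smooth_along A B f T (\<lambda>q. \<phi> (f q) (W q))"
      by (rule D_expand(1)[OF T(1,2) o T(3) finite_Basis a smooth[OF o E] \<phi>W_eq])
    have DW: "D p v W = (\<Sum>b\<in>Basis. dir_deriv A (a b) p v *\<^sub>R ?E b (f p) +
        a b p *\<^sub>R nabla (f p) (differential A B f p v) (?E b))"
      by (rule D_expand(2)[OF T(1,2) o T(3) finite_Basis a E W_eq])
    have "D p v (\<lambda>q. \<phi> (f q) (W q)) = (\<Sum>b\<in>Basis. dir_deriv A (a b) p v *\<^sub>R \<phi> (f p) (?E b (f p)) +
        a b p *\<^sub>R nabla (f p) (differential A B f p v) (\<lambda>x. \<phi> x (?E b x)))"
      by (rule D_expand(2)[OF T(1,2) o T(3) finite_Basis a smooth[OF o E] \<phi>W_eq])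
    also have "\<dots> = \<phi> (f p) (D p v W)"
      unfolding DW by (simp add: parallel[OF o E d(2)] linear_sum[OF lin] linear_scale[OF lin] linear_add[OF lin])
    finally have "D p v (\<lambda>q. \<phi> (f q) (W q)) = \<phi> (f p) (D p v W)" .
    then show ?thesis using T s\<phi>W by blast
  qed
  then show "smooth_along A B f U (\<lambda>q. \<phi> (f q) (W q))"
    by (intro smooth_along_Union) blast
  show "D p v (\<lambda>q. \<phi> (f q) (W q)) = \<phi> (f p) (D p v W)" if "p \<in> U" using *[OF that] by blast
qed

end

section \<open>Metric compatibility and vanishing torsion of the pulled back Levi-Civita
  connection\<close>

lemma riemannian_manifoldD:
  assumes "riemannian_manifold M"
  shows "smooth_atlas (atlas M)" "bilinear (metric M p)" "metric M p u v = metric M p v u"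
    "u \<noteq> 0 \<Longrightarrow> metric M p u u > 0"
    "open U \<Longrightarrow> smooth_field (atlas M) U X \<Longrightarrow> smooth_field (atlas M) U Y \<Longrightarrow>
      smooth_fun (atlas M) U (\<lambda>p. metric M p (X p) (Y p))"
  using assms unfolding riemannian_manifold_def by blast+

lemma levi_civitaD:
  assumes "levi_civita N nabla"
  shows "connection_along (atlas N) (atlas N) id nabla"
    "open U \<Longrightarrow> smooth_field (atlas N) U X \<Longrightarrow> smooth_field (atlas N) U Y \<Longrightarrow> p \<in> U \<Longrightarrow>
       nabla p (X p) Y - nabla p (Y p) X = lie_bracket (atlas N) X Y p"
    "open U \<Longrightarrow> smooth_field (atlas N) U X \<Longrightarrow> smooth_field (atlas N) U Y \<Longrightarrow> p \<in> U \<Longrightarrow>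
       dir_deriv (atlas N) (\<lambda>q. metric N q (X q) (Y q)) p v =
         metric N p (nabla p v X) (Y p) + metric N p (X p) (nabla p v Y)"
  using assms unfolding levi_civita_def by blast+

locale pullback_levi_civita = pullback "atlas M" "atlas N" f nabla D
  for M :: "('m::{t2_space, second_countable_topology}, 'd::euclidean_space, 'y) riem_scheme"
    and N :: "('n::{t2_space, second_countable_topology}, 'e::euclidean_space, 'z) riem_scheme"
    and f nabla D +
  assumes riemannian_N: "riemannian_manifold N" and levi_civita: "levi_civita N nabla"
begin

abbreviation "g \<equiv> metric N"

lemmas g_bilinear = riemannian_manifoldD(2)[OF riemannian_N]

lemma g_linear: "linear (\<lambda>u. g x u w)" "linear (g x w)"
  using g_bilinear[of x] by (auto simp: bilinear_def)

text \<open>Both fields are expanded in a coordinate frame of the target. Then \<open>g W W'\<close>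
  is a sum of products of coefficients with entries of the Gram matrix, whose derivatives are known
  from metric compatibility on the target.\<close>

lemma metric_along:
  assumes U: "open U" and W: "smooth_along (atlas M) (atlas N) f U W"
    and W': "smooth_along (atlas M) (atlas N) f U W'"
  shows "smooth_fun (atlas M) U (\<lambda>q. g (f q) (W q) (W' q))"
    and "p \<in> U \<Longrightarrow> dir_deriv (atlas M) (\<lambda>q. g (f q) (W q) (W' q)) p v =
      g (f p) (D p v W) (W' p) + g (f p) (W p) (D p v W')"
proof -
  have *: "\<exists>T. open T \<and> p \<in> T \<and> smooth_fun (atlas M) T (\<lambda>q. g (f q) (W q) (W' q)) \<and>
      dir_deriv (atlas M) (\<lambda>q. g (f q) (W q) (W' q)) p v =
      g (f p) (D p v W) (W' p) + g (f p) (W p) (D p v W')" if p: "p \<in> U" for p v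
  proof -
    define d where "d = chart_at (atlas N) (f p)"
    define T where "T = U \<inter> f -` fst d"
    define a where "a = (\<lambda>W b q. comps (atlas N) d (f q) (W q) \<bullet> b)"
    define E where "E = (\<lambda>b x. coord_vec (atlas N) d x b)"
    \<comment> \<open>The entries of the metric in the coordinate frame, indexed by pairs so that a
      single sum suffices.\<close>
    define G where "G = (\<lambda>bc x. g x (E (fst bc) x) (E (snd bc) x))"
    let ?I = "(Basis :: 'e set) \<times> (Basis :: 'e set)"
    let ?df = "differential (atlas M) (atlas N) f p v"
    have d: "d \<in> atlas N" "f p \<in> fst d" by (simp_all add: d_def B.chart_at)
    have T: "open T" "p \<in> T" "T \<subseteq> f -` fst d"
      unfolding T_def using U open_vimage_chart[OF d(1)] p d(2) by auto
    have a: "smooth_fun (atlas M) T (a Z b)" if "smooth_along (atlas M) (atlas N) f U Z" for b Z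
      unfolding a_def T_def by (rule A.smooth_fun_inner[OF T(1)[unfolded T_def] smooth_alongD[OF that d(1)]])
    note o = B.chart_props(1)[OF d(1)]
    have E: "smooth_field (atlas N) (fst d) (E b)" for b
      unfolding E_def by (rule B.smooth_field_coord_vec[OF d(1)])
    have Z_eq: "Z q = (\<Sum>b\<in>Basis. a Z b q *\<^sub>R E b (f q))" if "q \<in> T" for q Z
      unfolding a_def E_def by (rule along_frame) (use that T(3) d(1) in auto)
    have DZ: "D p v Z = (\<Sum>b\<in>Basis. dir_deriv (atlas M) (a Z b) p v *\<^sub>R E b (f p) +
        a Z b p *\<^sub>R nabla (f p) ?df (E b))" if "smooth_along (atlas M) (atlas N) f U Z" for Z
      by (rule D_expand(2)[OF T(1,2) o T(3) finite_Basis a[OF that] E Z_eq])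
    have G: "smooth_fun (atlas N) (fst d) (G bc)" for bc
      unfolding G_def by (rule riemannian_manifoldD(5)[OF riemannian_N o E E])
    have Gf: "smooth_fun (atlas M) T (\<lambda>q. G bc (f q))" for bc
      by (rule A.smooth_fun_subset[OF smooth_fun_comp[OF o G] T(3)])
    have dG: "dir_deriv (atlas M) (\<lambda>q. G bc (f q)) p v =
       g (f p) (nabla (f p) ?df (E (fst bc))) (E (snd bc) (f p)) +
       g (f p) (E (fst bc) (f p)) (nabla (f p) ?df (E (snd bc)))" for bc
      unfolding dir_deriv_comp[OF o G d(2)]
      unfolding G_def by (rule levi_civitaD(3)[OF levi_civita o E E d(2)])
    have gW: "(\<Sum>bc\<in>?I. a W (fst bc) q *\<^sub>R a W' (snd bc) q *\<^sub>R G bc (f q)) = g (f q) (W q) (W' q)"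
      if "q \<in> T" for q
      unfolding Z_eq[OF that, of W] Z_eq[OF that, of W'] bilinear_sum[OF g_bilinear]
      by (simp add: G_def bilinear_lmul[OF g_bilinear] bilinear_rmul[OF g_bilinear] case_prod_beta ac_simps)
    have s2: "smooth_fun (atlas M) T (\<lambda>q. a W' (snd bc) q *\<^sub>R G bc (f q))" for bc
      by (rule A.smooth_fun_scaleR[OF T(1) a[OF W'] Gf])
    have s3: "smooth_fun (atlas M) T (\<lambda>q. a W (fst bc) q *\<^sub>R a W' (snd bc) q *\<^sub>R G bc (f q))" for bc
      by (rule A.smooth_fun_scaleR[OF T(1) a[OF W] s2])
    have s4: "smooth_fun (atlas M) T (\<lambda>q. \<Sum>bc\<in>?I. a W (fst bc) q *\<^sub>R a W' (snd bc) q *\<^sub>R G bc (f q))"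
      by (rule A.smooth_fun_sum[OF T(1) s3])
    have s: "smooth_fun (atlas M) T (\<lambda>q. g (f q) (W q) (W' q))"
      by (rule A.smooth_fun_cong[OF T(1) gW s4])
    have "dir_deriv (atlas M) (\<lambda>q. g (f q) (W q) (W' q)) p v =
        dir_deriv (atlas M) (\<lambda>q. \<Sum>bc\<in>?I. a W (fst bc) q *\<^sub>R a W' (snd bc) q *\<^sub>R G bc (f q)) p v"
      by (rule A.dir_deriv_cong[OF T(1,2) gW s4, symmetric])
    also have "\<dots> = (\<Sum>bc\<in>?I. dir_deriv (atlas M) (\<lambda>q. a W (fst bc) q *\<^sub>R a W' (snd bc) q *\<^sub>R G bc (f q)) p v)"
      by (rule A.dir_deriv_sum[OF s3 T(2)])
    \<comment> \<open>The product rule yields three terms for each pair. They are regrouped so that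
      bilinearity reassembles the expansions of \<open>D p v W\<close> with \<open>W'\<close> and of
      \<open>W\<close> with \<open>D p v W'\<close>.\<close>
    also have "\<dots> = (\<Sum>bc\<in>?I.
        g (f p) (dir_deriv (atlas M) (a W (fst bc)) p v *\<^sub>R E (fst bc) (f p) + a W (fst bc) p *\<^sub>R nabla (f p) ?df (E (fst bc)))
          (a W' (snd bc) p *\<^sub>R E (snd bc) (f p)) +
        g (f p) (a W (fst bc) p *\<^sub>R E (fst bc) (f p))
          (dir_deriv (atlas M) (a W' (snd bc)) p v *\<^sub>R E (snd bc) (f p) + a W' (snd bc) p *\<^sub>R nabla (f p) ?df (E (snd bc))))"
      unfolding A.dir_deriv_scaleR[OF a[OF W] s2 T(2)] A.dir_deriv_scaleR[OF a[OF W'] Gf T(2)] dG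
      unfolding bilinear_lmul[OF g_bilinear] bilinear_rmul[OF g_bilinear] bilinear_ladd[OF g_bilinear]
        bilinear_radd[OF g_bilinear] G_def
      by (simp add: algebra_simps)
    also have "\<dots> = g (f p) (D p v W) (W' p) + g (f p) (W p) (D p v W')"
      unfolding DZ[OF W] DZ[OF W'] Z_eq[OF T(2), of W] Z_eq[OF T(2), of W'] bilinear_sum[OF g_bilinear]
      by (simp only: sum.distrib case_prod_unfold)
    finally show ?thesis using T s by blast
  qed
  then show "smooth_fun (atlas M) U (\<lambda>q. g (f q) (W q) (W' q))"
    by (intro A.smooth_fun_Union) blast
  show "dir_deriv (atlas M) (\<lambda>q. g (f q) (W q) (W' q)) p v =
      g (f p) (D p v W) (W' p) + g (f p) (W p) (D p v W')" if "p \<in> U" using *[OF that] by blast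
qed

text \<open>In a chart of the target the derivative of \<open>df Z\<close> is a second derivative of
  the coordinate expression \<open>F\<close> plus a Christoffel term. The difference of the first
  parts is the derivative of \<open>F\<close> along the bracket; the Christoffel terms
  cancel.\<close>

lemma torsion_along:
  assumes U: "open U" "p \<in> U" and X: "smooth_field (atlas M) U X" and Y: "smooth_field (atlas M) U Y"
  shows "D p (X p) (\<lambda>q. differential (atlas M) (atlas N) f q (Y q)) -
      D p (Y p) (\<lambda>q. differential (atlas M) (atlas N) f q (X q)) =
    differential (atlas M) (atlas N) f p (lie_bracket (atlas M) X Y p)"
proof -
  define d where "d = chart_at (atlas N) (f p)"
  define T where "T = U \<inter> f -` fst d"
  define F where "F = (\<lambda>q. snd d (f q))"
  define E where "E = (\<lambda>b x. coord_vec (atlas N) d x b)"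
  let ?df = "differential (atlas M) (atlas N) f"
  have d: "d \<in> atlas N" "f p \<in> fst d" by (simp_all add: d_def B.chart_at)
  have T: "open T" "p \<in> T" "T \<subseteq> f -` fst d" "T \<subseteq> U"
    unfolding T_def using U open_vimage_chart[OF d(1)] d(2) by auto
  note o = B.chart_props(1)[OF d(1)]
  have E: "smooth_field (atlas N) (fst d) (E b)" for b
    unfolding E_def by (rule B.smooth_field_coord_vec[OF d(1)])
  \<comment> \<open>The chart \<open>d\<close> is the preferred one at \<open>f p\<close>, so there
    the coordinate frame is the standard basis.\<close>
  have E_p: "E b (f p) = b" for b
    using B.coord_vec_comps[OF d, of b] B.comps_self[of "f p" b] by (simp add: E_def d_def)
  have F: "smooth_fun (atlas M) T F"
    unfolding F_def by (rule A.smooth_fun_subset[OF smooth_fun_coord[OF d(1)] T(3)])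
  have df: "?df p v = dir_deriv (atlas M) F p v" for v
    by (simp add: differential_def F_def d_def o_def)
  have comps: "comps (atlas N) d (f q) (?df q v) = dir_deriv (atlas M) F q v" if "q \<in> T" for q v
    unfolding F_def by (rule comps_differential[OF d(1)]) (use that T(3) in auto)
  have field: "smooth_field (atlas M) T Z" if "smooth_field (atlas M) U Z" for Z
    by (rule A.smooth_field_subset[OF that T(4)])
  \<comment> \<open>Coordinate fields have constant components, so their brackets vanish and zero
    torsion becomes the symmetry of the Christoffel symbols in \<open>sym\<close>.\<close>
  have zero: "dir_deriv (atlas N) (\<lambda>x. comps (atlas N) d x (E b x)) (f p) u = 0" for b u
    using B.dir_deriv_cong[OF o d(2) _ B.smooth_fun_const[of _ b], of "\<lambda>x. comps (atlas N) d x (E b x)" u]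
      B.comps_coord_vec[OF d(1)] by (simp add: E_def B.dir_deriv_const)
  have sym: "nabla (f p) b (E c) = nabla (f p) c (E b)" for b c
    using levi_civitaD(2)[OF levi_civita o E[of b] E[of c] d(2)]
    by (simp add: lie_bracket_def d_def[symmetric] zero E_p)
  have lin: "linear (\<lambda>u. nabla (f p) u (E b))" for b
    by (rule levi_civitaD(1)[OF levi_civita, unfolded connection_along_def, THEN spec, THEN spec, THEN mp,
          OF conjI[OF o E[unfolded smooth_field_def]], THEN conjunct1, THEN bspec, OF d(2)])
  have *: "D p v (\<lambda>q. ?df q (Z q)) = dir_deriv (atlas M) (\<lambda>q. dir_deriv (atlas M) F q (Z q)) p v +
      (\<Sum>b\<in>Basis. \<Sum>c\<in>Basis. ((?df p (Z p) \<bullet> b) * (?df p v \<bullet> c)) *\<^sub>R nabla (f p) c (E b))"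
    if Z: "smooth_field (atlas M) U Z" for Z v
  proof -
    let ?a = "\<lambda>q. dir_deriv (atlas M) F q (Z q)"
    have a: "smooth_fun (atlas M) T ?a" by (rule A.smooth_fun_dir_deriv[OF T(1) F field[OF Z]])
    have eq: "?df q (Z q) = (\<Sum>b\<in>Basis. (?a q \<bullet> b) *\<^sub>R E b (f q))" if "q \<in> T" for q
      unfolding comps[OF that, symmetric] E_def
      by (rule along_frame[where W = "\<lambda>q. ?df q (Z q)"]) (use that T(3) d(1) in auto)
    have "D p v (\<lambda>q. ?df q (Z q)) = (\<Sum>b\<in>Basis. dir_deriv (atlas M) (\<lambda>q. ?a q \<bullet> b) p v *\<^sub>R E b (f p) +
        (?a p \<bullet> b) *\<^sub>R nabla (f p) (?df p v) (E b))"
      by (rule D_expand(2)[OF T(1,2) o T(3) finite_Basis A.smooth_fun_inner[OF T(1) a] E eq])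
    also have "\<dots> = dir_deriv (atlas M) ?a p v + (\<Sum>b\<in>Basis. (?a p \<bullet> b) *\<^sub>R nabla (f p) (?df p v) (E b))"
      unfolding A.dir_deriv_inner[OF a T(2)] E_p sum.distrib euclidean_representation ..
    also have "(\<Sum>b\<in>Basis. (?a p \<bullet> b) *\<^sub>R nabla (f p) (?df p v) (E b)) =
        (\<Sum>b\<in>Basis. \<Sum>c\<in>Basis. ((?df p (Z p) \<bullet> b) * (?df p v \<bullet> c)) *\<^sub>R nabla (f p) c (E b))"
    proof (rule sum.cong[OF refl])
      fix b :: 'e
      have "nabla (f p) (?df p v) (E b) = nabla (f p) (\<Sum>c\<in>Basis. (?df p v \<bullet> c) *\<^sub>R c) (E b)"
        by (simp add: euclidean_representation)
      also have "\<dots> = (\<Sum>c\<in>Basis. (?df p v \<bullet> c) *\<^sub>R nabla (f p) c (E b))"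
        by (simp add: linear_sum[OF lin] linear_scale[OF lin])
      finally show "(?a p \<bullet> b) *\<^sub>R nabla (f p) (?df p v) (E b) =
          (\<Sum>c\<in>Basis. ((?df p (Z p) \<bullet> b) * (?df p v \<bullet> c)) *\<^sub>R nabla (f p) c (E b))"
        by (simp add: df scaleR_sum_right)
    qed
    finally show ?thesis .
  qed
  \<comment> \<open>The Christoffel terms for \<open>X\<close> and \<open>Y\<close> agree after the
    summation indices are exchanged.\<close>
  have "(\<Sum>b\<in>Basis. \<Sum>c\<in>Basis. ((?df p (Y p) \<bullet> b) * (?df p (X p) \<bullet> c)) *\<^sub>R nabla (f p) c (E b)) =
      (\<Sum>c\<in>Basis. \<Sum>b\<in>Basis. ((?df p (X p) \<bullet> c) * (?df p (Y p) \<bullet> b)) *\<^sub>R nabla (f p) b (E c))"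
    by (subst sum.swap, intro sum.cong refl arg_cong2[where f = scaleR] mult.commute sym)
  then show ?thesis
    using A.dir_deriv_lie_bracket[OF T(1,2) F field[OF X] field[OF Y]]
    unfolding *[OF X] *[OF Y] df by simp
qed

end


section \<open>Isometric immersions\<close>

text \<open>Gram--Schmidt without normalisation, applied to part of a coordinate frame.\<close>

lemma orthogonal_frame_on:
  assumes M: "riemannian_manifold M" and c: "c \<in> atlas M" and S: "finite S" "S \<subseteq> Basis"
  shows "\<exists>F. (\<forall>b\<in>S. smooth_field (atlas M) (fst c) (F b)) \<and>
    (\<forall>q\<in>fst c. (\<forall>b\<in>S. F b q \<noteq> 0) \<and> (\<forall>b\<in>S. \<forall>b'\<in>S. b \<noteq> b' \<longrightarrow> metric M q (F b q) (F b' q) = 0) \<and>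
       span ((\<lambda>b. F b q) ` S) = span (coord_vec (atlas M) c q ` S))"
proof -
  interpret manifold "atlas M" by unfold_locales (rule riemannian_manifoldD(1)[OF M])
  let ?E = "coord_vec (atlas M) c"
  note bil = riemannian_manifoldD(2)[OF M] and sym = riemannian_manifoldD(3)[OF M]
    and pos = riemannian_manifoldD(4)[OF M] and o = chart_props(1)[OF c]
  show ?thesis
    using S
  proof (induction S)
    case empty
    then show ?case by simp
  next
    case (insert a S)
    have "S \<subseteq> Basis" using insert.prems by simp
    from insert.IH[OF this] obtain F where F0: "\<forall>b\<in>S. smooth_field (atlas M) (fst c) (F b)"
      "\<forall>q\<in>fst c. (\<forall>b\<in>S. F b q \<noteq> 0) \<and> (\<forall>b\<in>S. \<forall>b'\<in>S. b \<noteq> b' \<longrightarrow> metric M q (F b q) (F b' q) = 0) \<and>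
       span ((\<lambda>b. F b q) ` S) = span (?E q ` S)"
      by (elim exE conjE) (rule that; assumption)
    then have F: "\<And>b. b \<in> S \<Longrightarrow> smooth_field (atlas M) (fst c) (F b)"
      "\<And>q b. q \<in> fst c \<Longrightarrow> b \<in> S \<Longrightarrow> F b q \<noteq> 0"
      "\<And>q b b'. q \<in> fst c \<Longrightarrow> b \<in> S \<Longrightarrow> b' \<in> S \<Longrightarrow> b \<noteq> b' \<Longrightarrow> metric M q (F b q) (F b' q) = 0"
      "\<And>q. q \<in> fst c \<Longrightarrow> span ((\<lambda>b. F b q) ` S) = span (?E q ` S)"
      by blast+
    \<comment> \<open>Gram--Schmidt coefficients. Dividing by the squared length keeps them smooth
      without square roots.\<close>
    define k where "k = (\<lambda>b q. metric M q (?E q a) (F b q) *\<^sub>R inverse (metric M q (F b q) (F b q)))"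
    define P where "P = (\<lambda>q. \<Sum>b\<in>S. k b q *\<^sub>R F b q)"
    define G where "G = F(a := \<lambda>q. ?E q a - P q)"
    have a: "a \<notin> S" "a \<in> Basis" "S \<subseteq> Basis" using insert by auto
    have G_simps: "G a q = ?E q a - P q" "b \<in> S \<Longrightarrow> G b = F b" for b q
      using a(1) by (auto simp: G_def)
    have G_image: "(\<lambda>b. G b q) ` insert a S = insert (?E q a - P q) ((\<lambda>b. F b q) ` S)" for q
      using G_simps by (auto simp: image_iff)
    have P_span: "P q \<in> span ((\<lambda>b. F b q) ` S)" for q
      unfolding P_def by (intro span_sum span_scale span_base) auto
    have ne: "metric M q (F b q) (F b q) \<noteq> 0" if "q \<in> fst c" "b \<in> S" for q b
      using pos[OF F(2)[OF that], of q] by simp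
    have k: "smooth_fun (atlas M) (fst c) (k b)" if "b \<in> S" for b
      unfolding k_def
      by (rule smooth_fun_scaleR[OF o riemannian_manifoldD(5)[OF M o smooth_field_coord_vec[OF c] F(1)[OF that]]
            smooth_fun_inverse[OF o riemannian_manifoldD(5)[OF M o F(1)[OF that] F(1)[OF that]] ne[OF _ that]]])
    have P: "smooth_field (atlas M) (fst c) P"
      unfolding P_def by (rule smooth_field_sum[OF o smooth_field_scaleR[OF o k F(1)]])
    have Ga: "smooth_field (atlas M) (fst c) (G a)"
      unfolding G_simps(1)[abs_def] by (rule smooth_field_diff[OF o smooth_field_coord_vec[OF c] P])
    \<comment> \<open>Otherwise \<open>?E q a\<close> would lie in the span of the coordinate
      vectors of \<open>S\<close>; applying \<open>comps\<close> would put the basis vector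
      \<open>a\<close> in the span of the other basis vectors. This is why the induction also
      carries the equality of spans.\<close>
    have nz: "?E q a - P q \<noteq> 0" if q: "q \<in> fst c" for q
    proof
      assume "?E q a - P q = 0"
      then have "?E q a \<in> span (?E q ` S)" using P_span[of q] F(4)[OF q] by simp
      then have "?E q a \<in> ?E q ` span S"
        using linear_span_image[OF coord_vec_linear[OF c q], of S] by simp
      then obtain w where w: "w \<in> span S" "?E q a = ?E q w" by blast
      then have "a = w" using comps_coord_vec[OF c q] by metis
      then have "a \<in> span (Basis - {a})" using w(1) a span_mono[of S "Basis - {a}"] by blast
      then show False using independent_Basis a(2) dependent_def by blast
    qed
    have orth: "metric M q (?E q a - P q) (F b q) = 0" if q: "q \<in> fst c" and b: "b \<in> S" for q b
    proof -
      have lin: "linear (\<lambda>u. metric M q u (F b q))" using bil[of q] by (simp add: bilinear_def)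
      have "metric M q (P q) (F b q) = (\<Sum>b'\<in>S. k b' q * metric M q (F b' q) (F b q))"
        unfolding P_def by (simp add: linear_sum[OF lin] linear_scale[OF lin])
      also have "\<dots> = (\<Sum>b'\<in>S. if b' = b then k b q * metric M q (F b q) (F b q) else 0)"
        by (rule sum.cong) (use F(3)[OF q _ b] in auto)
      also have "\<dots> = k b q * metric M q (F b q) (F b q)" using insert(1) b by simp
      also have "\<dots> = metric M q (?E q a) (F b q)" using ne[OF q b] by (simp add: k_def)
      finally show ?thesis by (simp add: bilinear_lsub[OF bil])
    qed
    have span: "span (insert (?E q a - P q) ((\<lambda>b. F b q) ` S)) = span (insert (?E q a) (?E q ` S))"
      if q: "q \<in> fst c" for q
    proof -
      have "span (insert (?E q a - P q) ((\<lambda>b. F b q) ` S)) = span (insert (?E q a) ((\<lambda>b. F b q) ` S))"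
        by (rule eq_span_insert_eq) (use P_span[of q] span_neg in auto)
      then show ?thesis by (simp only: span_insert F(4)[OF q])
    qed
    show ?case
    proof (intro exI[of _ G] conjI ballI impI)
      show "smooth_field (atlas M) (fst c) (G b)" if "b \<in> insert a S" for b
        using that Ga F(1) G_simps(2) by auto
      fix q assume q: "q \<in> fst c"
      show "G b q \<noteq> 0" if "b \<in> insert a S" for b
        using that nz[OF q] F(2)[OF q] G_simps by (cases "b = a") auto
      show "metric M q (G b q) (G b' q) = 0" if "b \<in> insert a S" "b' \<in> insert a S" "b \<noteq> b'" for b b'
      proof -
        from that consider "b = a" "b' \<in> S" | "b \<in> S" "b' = a" | "b \<in> S" "b' \<in> S"
          by blast
        then show ?thesis
          using orth[OF q] F(3)[OF q] that(3) sym[of q "G b q"] by cases (simp_all add: G_simps)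
      qed
      show "span ((\<lambda>b. G b q) ` insert a S) = span (?E q ` insert a S)"
        unfolding G_image using span[OF q] by simp
    qed
  qed
qed

lemma orthogonal_frame:
  fixes M :: "('m::{t2_space, second_countable_topology}, 'd::euclidean_space, 'y) riem_scheme"
  assumes M: "riemannian_manifold M" and c: "c \<in> atlas M"
  obtains F :: "'d \<Rightarrow> 'm \<Rightarrow> 'd" where "\<And>b. b \<in> Basis \<Longrightarrow> smooth_field (atlas M) (fst c) (F b)"
    "\<And>q b. q \<in> fst c \<Longrightarrow> b \<in> Basis \<Longrightarrow> F b q \<noteq> 0"
    "\<And>q b b'. q \<in> fst c \<Longrightarrow> b \<in> Basis \<Longrightarrow> b' \<in> Basis \<Longrightarrow> b \<noteq> b' \<Longrightarrow> metric M q (F b q) (F b' q) = 0"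
    "\<And>q. q \<in> fst c \<Longrightarrow> span ((\<lambda>b. F b q) ` Basis) = UNIV"
proof -
  interpret manifold "atlas M" by unfold_locales (rule riemannian_manifoldD(1)[OF M])
  have span: "span (coord_vec (atlas M) c q ` Basis) = UNIV" if "q \<in> fst c" for q
  proof -
    have "range (coord_vec (atlas M) c q) = UNIV"
      using coord_vec_comps[OF c that] by (metis surjI)
    then show ?thesis
      using linear_span_image[OF coord_vec_linear[OF c that], of Basis] by simp
  qed
  obtain F :: "'d \<Rightarrow> 'm \<Rightarrow> 'd" where F: "\<forall>b\<in>Basis. smooth_field (atlas M) (fst c) (F b)"
      "\<forall>q\<in>fst c. (\<forall>b\<in>Basis. F b q \<noteq> 0) \<and>
         (\<forall>b\<in>Basis. \<forall>b'\<in>Basis. b \<noteq> b' \<longrightarrow> metric M q (F b q) (F b' q) = 0) \<and>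
         span ((\<lambda>b. F b q) ` Basis) = span (coord_vec (atlas M) c q ` Basis)"
    using orthogonal_frame_on[OF M c finite_Basis subset_refl] by (elim exE conjE) (rule that; assumption)
  show thesis by (rule that[of F]) (use F span in blast)+
qed

section \<open>Tangential and normal parts along an isometric immersion\<close>

locale immersion = pullback_levi_civita M N f nabla D
  for M :: "('m::{t2_space, second_countable_topology}, 'd::euclidean_space, 'y) riem_scheme"
    and N :: "('n::{t2_space, second_countable_topology}, 'e::euclidean_space, 'z) riem_scheme"
    and f nabla D +
  assumes immersion: "isometric_immersion M N f"
begin

abbreviation "m \<equiv> metric M"
abbreviation "df \<equiv> push M N f"
abbreviation "tan_part \<equiv> tangent_part M N f"
abbreviation "nor_part \<equiv> normal_part M N f"

lemma riemannian_M: "riemannian_manifold M"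
  using immersion by (simp add: isometric_immersion_def)

lemma isometric: "g (f p) (df p u) (df p v) = m p u v"
  using immersion by (simp add: isometric_immersion_def)

lemma df_eq: "df = differential (atlas M) (atlas N) f"
  by (simp add: push_def fun_eq_iff)

lemma df_linear: "linear (df p)"
  unfolding df_eq by (rule differential_linear)

lemma g_sym: "g x u v = g x v u"
  by (rule riemannian_manifoldD(3)[OF riemannian_N])

lemma normal_spaceD: "w \<in> normal_space M N f p \<Longrightarrow> g (f p) w (df p u) = 0"
  by (simp add: normal_space_def)

text \<open>The push-forward of the difference of two candidates is both tangent and normal. Its
  squared length is therefore zero, and by isometry so is that of the difference.\<close>

lemma tan_part_unique:
  assumes "w - df p u \<in> normal_space M N f p"
  shows "tan_part p w = u"
  unfolding tangent_part_def
proof (rule the_equality)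
  show "w - df p u \<in> normal_space M N f p" by (rule assms)
  fix u' assume u': "w - df p u' \<in> normal_space M N f p"
  have "m p (u - u') (u - u') = g (f p) ((w - df p u') - (w - df p u)) (df p (u - u'))"
    by (simp add: isometric[symmetric] linear_diff[OF df_linear])
  also have "\<dots> = 0"
    by (subst bilinear_lsub[OF g_bilinear]) (simp only: normal_spaceD[OF assms] normal_spaceD[OF u'] diff_self)
  finally show "u' = u"
    using riemannian_manifoldD(4)[OF riemannian_M, of "u - u'" p] by force
qed

text \<open>The explicit projection formula serves twice: evaluated at one point it proves that
  tangential parts exist, and over a smooth frame that they vary smoothly.\<close>

lemma orthogonal_expansion_normal:
  fixes F :: "'d \<Rightarrow> 'd"
  assumes nz: "\<And>b. b \<in> Basis \<Longrightarrow> F b \<noteq> 0"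
    and orth: "\<And>b b'. b \<in> Basis \<Longrightarrow> b' \<in> Basis \<Longrightarrow> b \<noteq> b' \<Longrightarrow> m p (F b) (F b') = 0"
    and span: "span (F ` Basis) = UNIV"
  shows "w - df p (\<Sum>b\<in>Basis. (g (f p) w (df p (F b)) *\<^sub>R inverse (m p (F b) (F b))) *\<^sub>R F b)
    \<in> normal_space M N f p"
proof -
  define k where "k = (\<lambda>b. g (f p) w (df p (F b)) *\<^sub>R inverse (m p (F b) (F b)))"
  let ?u = "\<Sum>b\<in>Basis. k b *\<^sub>R F b"
  have "linear (\<lambda>u. g (f p) (w - df p ?u) (df p u))"
    using linear_compose[OF df_linear g_linear(2)] by (simp add: o_def)
  moreover have "g (f p) (w - df p ?u) (df p u) = 0" if "u \<in> F ` Basis" for u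
  proof -
    from that obtain b where b: "b \<in> Basis" "u = F b" by blast
    have lin: "linear (\<lambda>u. m p u (F b))"
      using riemannian_manifoldD(2)[OF riemannian_M, of p] by (simp add: bilinear_def)
    have "m p ?u (F b) = (\<Sum>b'\<in>Basis. k b' * m p (F b') (F b))"
      by (simp add: linear_sum[OF lin] linear_scale[OF lin])
    also have "\<dots> = (\<Sum>b'\<in>Basis. if b' = b then k b * m p (F b) (F b) else 0)"
      by (rule sum.cong) (use orth[OF _ b(1)] in auto)
    also have "\<dots> = k b * m p (F b) (F b)" using b by simp
    also have "\<dots> = g (f p) w (df p (F b))"
      using riemannian_manifoldD(4)[OF riemannian_M nz[OF b(1)], of p] by (simp add: k_def)
    finally show ?thesis by (simp add: bilinear_lsub[OF g_bilinear] isometric b(2))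
  qed
  ultimately have "g (f p) (w - df p ?u) (df p u) = 0" for u
    by (rule linear_eq_0_on_span[where b = "F ` Basis"])
      (use span in \<open>auto simp only: UNIV_I\<close>)
  then show ?thesis by (simp add: normal_space_def k_def)
qed

text \<open>This is the existence half of the orthogonal decomposition; with uniqueness it shows
  that the \<open>THE\<close> in \<open>tangent_part\<close> picks a genuine tangential
  part.\<close>

lemma nor_part_normal: "nor_part p w \<in> normal_space M N f p"
proof -
  obtain F :: "'d \<Rightarrow> 'm \<Rightarrow> 'd" where F: "\<And>b. b \<in> Basis \<Longrightarrow> smooth_field (atlas M) (fst (chart_at (atlas M) p)) (F b)"
    "\<And>q b. q \<in> fst (chart_at (atlas M) p) \<Longrightarrow> b \<in> Basis \<Longrightarrow> F b q \<noteq> 0"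
    "\<And>q b b'. q \<in> fst (chart_at (atlas M) p) \<Longrightarrow> b \<in> Basis \<Longrightarrow> b' \<in> Basis \<Longrightarrow> b \<noteq> b' \<Longrightarrow> m q (F b q) (F b' q) = 0"
    "\<And>q. q \<in> fst (chart_at (atlas M) p) \<Longrightarrow> span ((\<lambda>b. F b q) ` Basis) = UNIV"
    by (rule orthogonal_frame[OF riemannian_M A.chart_at(1)]) (rule that; assumption)
  from orthogonal_expansion_normal[of "\<lambda>b. F b p", OF F(2-4)[OF A.chart_at(2)]]
  obtain u where u: "w - df p u \<in> normal_space M N f p" by blast
  then show ?thesis using tan_part_unique[OF u] by (simp add: normal_part_def)
qed

lemma m_tan_part: "m p (tan_part p w) u = g (f p) w (df p u)"
  using normal_spaceD[OF nor_part_normal, of p w u]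
  by (simp add: normal_part_def bilinear_lsub[OF g_bilinear] isometric)

lemma g_nor_part:
  assumes "V \<in> normal_space M N f p"
  shows "g (f p) (nor_part p w) V = g (f p) w V"
  using normal_spaceD[OF assms]
  by (simp add: normal_part_def bilinear_rsub[OF g_bilinear] g_sym[of _ _ V])

lemma smooth_along_df:
  "open U \<Longrightarrow> smooth_field (atlas M) U X \<Longrightarrow> smooth_along (atlas M) (atlas N) f U (\<lambda>q. df q (X q))"
  unfolding df_eq by (rule smooth_along_differential)

lemma smooth_tan_part:
  assumes U: "open U" and W: "smooth_along (atlas M) (atlas N) f U W"
  shows "smooth_field (atlas M) U (\<lambda>q. tan_part q (W q))"
proof (rule A.smooth_field_Union)
  fix p assume p: "p \<in> U"
  define c where "c = chart_at (atlas M) p"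
  define T where "T = U \<inter> fst c"
  have c: "c \<in> atlas M" "p \<in> fst c" by (simp_all add: c_def A.chart_at)
  obtain F :: "'d \<Rightarrow> 'm \<Rightarrow> 'd" where F: "\<And>b. b \<in> Basis \<Longrightarrow> smooth_field (atlas M) (fst c) (F b)"
    "\<And>q b. q \<in> fst c \<Longrightarrow> b \<in> Basis \<Longrightarrow> F b q \<noteq> 0"
    "\<And>q b b'. q \<in> fst c \<Longrightarrow> b \<in> Basis \<Longrightarrow> b' \<in> Basis \<Longrightarrow> b \<noteq> b' \<Longrightarrow> m q (F b q) (F b' q) = 0"
    "\<And>q. q \<in> fst c \<Longrightarrow> span ((\<lambda>b. F b q) ` Basis) = UNIV"
    by (rule orthogonal_frame[OF riemannian_M c(1)]) (rule that; assumption)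
  have T: "open T" "p \<in> T" unfolding T_def using U A.chart_props(1)[OF c(1)] p c(2) by auto
  have F_T: "smooth_field (atlas M) T (F b)" if "b \<in> Basis" for b
    by (rule A.smooth_field_subset[OF F(1)[OF that]]) (simp add: T_def)
  have W_T: "smooth_along (atlas M) (atlas N) f T W"
    by (rule smooth_along_subset[OF W]) (simp add: T_def)
  define k where "k = (\<lambda>b q. g (f q) (W q) (df q (F b q)) *\<^sub>R inverse (m q (F b q) (F b q)))"
  have ne: "m q (F b q) (F b q) \<noteq> 0" if "q \<in> T" "b \<in> Basis" for q b
    using riemannian_manifoldD(4)[OF riemannian_M F(2), of q b q] that by (simp add: T_def)
  have k: "smooth_fun (atlas M) T (k b)" if "b \<in> Basis" for b
    unfolding k_def
    by (rule A.smooth_fun_scaleR[OF T(1) metric_along(1)[OF T(1) W_T smooth_along_df[OF T(1) F_T[OF that]]]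
          A.smooth_fun_inverse[OF T(1) riemannian_manifoldD(5)[OF riemannian_M T(1) F_T[OF that] F_T[OF that]] ne[OF _ that]]])
  have eq: "(\<Sum>b\<in>Basis. k b q *\<^sub>R F b q) = tan_part q (W q)" if "q \<in> T" for q
    unfolding k_def
    by (rule tan_part_unique[symmetric], rule orthogonal_expansion_normal) (use that F(2-4) in \<open>auto simp: T_def\<close>)
  have "smooth_field (atlas M) T (\<lambda>q. \<Sum>b\<in>Basis. k b q *\<^sub>R F b q)"
    by (rule A.smooth_field_sum[OF T(1) A.smooth_field_scaleR[OF T(1) k F_T]])
  then have "smooth_field (atlas M) T (\<lambda>q. tan_part q (W q))"
    by (rule A.smooth_field_cong[OF T(1), rotated]) (rule eq)
  then show "\<exists>T. open T \<and> p \<in> T \<and> smooth_field (atlas M) T (\<lambda>q. tan_part q (W q))"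
    using T by blast
qed

lemma smooth_nor_part:
  assumes "open U" "smooth_along (atlas M) (atlas N) f U W"
  shows "smooth_along (atlas M) (atlas N) f U (\<lambda>q. nor_part q (W q))"
  unfolding normal_part_def
  by (rule smooth_along_diff[OF assms smooth_along_df[OF assms(1) smooth_tan_part[OF assms]]])

text \<open>The Weingarten formula, from differentiating \<open>g V (df Y) = 0\<close>.\<close>

lemma m_shape_operator:
  assumes V: "V \<in> normal_fields M N f" and Y: "Y \<in> tangent_fields M"
  shows "m p (shape_operator M N f D V X p) (Y p) = g (f p) (V p) (D p (X p) (\<lambda>q. df q (Y q)))"
proof -
  have sV: "smooth_along (atlas M) (atlas N) f UNIV V"
    and sY: "smooth_along (atlas M) (atlas N) f UNIV (\<lambda>q. df q (Y q))"
    using V Y by (auto simp: normal_fields_def tangent_fields_def intro: smooth_along_df)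
  have "(\<lambda>q. g (f q) (V q) (df q (Y q))) = (\<lambda>q. 0)"
    using V by (simp add: normal_fields_def normal_spaceD)
  then have "g (f p) (D p (X p) V) (df p (Y p)) + g (f p) (V p) (D p (X p) (\<lambda>q. df q (Y q))) = 0"
    using metric_along(2)[OF open_UNIV sV sY UNIV_I, of p "X p"] by (simp add: A.dir_deriv_const)
  then show ?thesis
    using bilinear_lneg[OF riemannian_manifoldD(2)[OF riemannian_M]]
    by (simp add: shape_operator_def m_tan_part)
qed

text \<open>The two derivatives differ by the push-forward of a Lie bracket, which is tangent and
  hence orthogonal to \<open>V\<close>.\<close>

lemma second_fundamental_form_symmetric:
  assumes "X \<in> tangent_fields M" "Y \<in> tangent_fields M" "V \<in> normal_space M N f p"
  shows "g (f p) V (D p (X p) (\<lambda>q. df q (Y q))) = g (f p) V (D p (Y p) (\<lambda>q. df q (X q)))"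
proof -
  have "D p (X p) (\<lambda>q. df q (Y q)) - D p (Y p) (\<lambda>q. df q (X q)) = df p (lie_bracket (atlas M) X Y p)"
    unfolding df_eq using assms by (intro torsion_along[of UNIV]) (auto simp: tangent_fields_def)
  then have "g (f p) V (D p (X p) (\<lambda>q. df q (Y q)) - D p (Y p) (\<lambda>q. df q (X q))) = 0"
    using normal_spaceD[OF assms(3)] by simp
  then show ?thesis by (simp add: bilinear_rsub[OF g_bilinear])
qed

end

section \<open>Immersions into cosymplectic manifolds\<close>

lemma cosymplectic_phi:
  assumes "cosymplectic N nabla"
  shows "linear (phi N x)"
    and "open U \<Longrightarrow> smooth_field (atlas N) U Y \<Longrightarrow> smooth_field (atlas N) U (\<lambda>x. phi N x (Y x))"
    and "open U \<Longrightarrow> smooth_field (atlas N) U Y \<Longrightarrow> x \<in> U \<Longrightarrow>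
      nabla x v (\<lambda>q. phi N q (Y q)) = phi N x (nabla x v Y)"
    and "metric N x (phi N x u) v = - metric N x u (phi N x v)"
proof -
  have acm: "almost_contact_metric N" using assms by (simp add: cosymplectic_def)
  show "linear (phi N x)" using acm by (simp add: almost_contact_metric_def)
  show "open U \<Longrightarrow> smooth_field (atlas N) U Y \<Longrightarrow> smooth_field (atlas N) U (\<lambda>x. phi N x (Y x))"
    using acm unfolding almost_contact_metric_def by meson
  show "open U \<Longrightarrow> smooth_field (atlas N) U Y \<Longrightarrow> x \<in> U \<Longrightarrow>
      nabla x v (\<lambda>q. phi N q (Y q)) = phi N x (nabla x v Y)"
    by (rule eq_iff_diff_eq_0[THEN iffD2])
      (rule assms[unfolded cosymplectic_def, THEN conjunct2, THEN conjunct2, THEN spec, THEN spec,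
          THEN mp, OF conjI, THEN bspec, THEN spec])
  have bil: "bilinear (metric N x)"
    using acm riemannian_manifoldD(2) by (auto simp: almost_contact_metric_def)
  have compat: "\<forall>p u v. metric N p (phi N p u) (phi N p v) = metric N p u v - eta N p u * eta N p v"
    using acm unfolding almost_contact_metric_def by (elim conjE) assumption
  have phi_phi: "\<forall>p u. phi N p (phi N p u) = - u + eta N p u *\<^sub>R xi N p"
    using acm unfolding almost_contact_metric_def by (elim conjE) assumption
  have eta_phi: "\<forall>p u. eta N p (phi N p u) = 0"
    using acm unfolding almost_contact_metric_def by (elim conjE) assumption
  have eta_xi: "\<forall>p u. eta N p u = metric N p u (xi N p)"
    using acm unfolding almost_contact_metric_def by (elim conjE) assumption
  \<comment> \<open>Compatibility is used with \<open>phi v\<close> as second argument: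
    \<open>phi (phi v)\<close> is expanded and the correction drops out, as \<open>eta\<close>
    vanishes on the image of \<open>phi\<close>. For the same reason \<open>phi u\<close> is
    orthogonal to \<open>xi\<close>, which leaves skew-adjointness.\<close>
  have "metric N x (phi N x u) (- v + eta N x v *\<^sub>R xi N x) = metric N x u (phi N x v)"
    using compat[rule_format, of x u "phi N x v"] eta_phi by (simp only: phi_phi)
  moreover have "metric N x (phi N x u) (xi N x) = 0"
    using eta_phi eta_xi by metis
  ultimately show "metric N x (phi N x u) v = - metric N x u (phi N x v)"
    by (simp add: bilinear_rsub[OF bil] bilinear_rmul[OF bil])
qed

locale cosymplectic_immersion = immersion M N f nabla D
  for M :: "('m::{t2_space, second_countable_topology}, 'd::euclidean_space, 'y) riem_scheme"
    and N :: "('n::{t2_space, second_countable_topology}, 'e::euclidean_space) acm"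
    and f nabla D +
  assumes cosymplectic: "cosymplectic N nabla"
begin

lemmas phi = cosymplectic_phi[OF cosymplectic]

lemma D_phi:
  assumes "open U" "smooth_along (atlas M) (atlas N) f U W"
  shows "smooth_along (atlas M) (atlas N) f U (\<lambda>q. phi N (f q) (W q))"
    and "p \<in> U \<Longrightarrow> D p v (\<lambda>q. phi N (f q) (W q)) = phi N (f p) (D p v W)"
  by (rule D_endomorphism[where \<phi> = "phi N" and U = U];
      (rule phi(1) | rule phi(2); assumption | rule phi(3); assumption | rule assms | assumption))+

lemma deriv_F_eq_shape_operator:
  assumes X: "X \<in> tangent_fields M" and Y: "Y \<in> tangent_fields M" and V: "V \<in> normal_fields M N f"
  shows "g (f p) (deriv_F M N f D X Y p) (V p) =
    - m p (shape_operator M N f D (\<lambda>q. C_op M N f q (V q)) Y p) (X p)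
    - m p (shape_operator M N f D V X p) (T_op M N f p (Y p))"
proof -
  let ?W = "\<lambda>q. df q (Y q)" and ?T = "\<lambda>q. T_op M N f q (Y q)" and ?C = "\<lambda>q. C_op M N f q (V q)"
  let ?DW = "D p (X p) ?W"
  have W: "smooth_along (atlas M) (atlas N) f UNIV ?W"
    using Y by (auto simp: tangent_fields_def intro: smooth_along_df)
  have \<phi>W: "smooth_along (atlas M) (atlas N) f UNIV (\<lambda>q. phi N (f q) (?W q))"
    by (rule D_phi(1)[OF open_UNIV W])
  have T: "?T \<in> tangent_fields M"
    unfolding tangent_fields_def T_op_def using smooth_tan_part[OF open_UNIV \<phi>W] by blast
  have dfT: "smooth_along (atlas M) (atlas N) f UNIV (\<lambda>q. df q (?T q))"
    using T by (auto simp: tangent_fields_def intro: smooth_along_df)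
  have V_p: "V p \<in> normal_space M N f p" using V by (simp add: normal_fields_def)
  have sV: "smooth_along (atlas M) (atlas N) f UNIV V" using V by (simp add: normal_fields_def)
  have C: "?C \<in> normal_fields M N f"
    unfolding normal_fields_def C_op_def
    using smooth_nor_part[OF open_UNIV D_phi(1)[OF open_UNIV sV]] nor_part_normal by blast
  \<comment> \<open>The normal part is split so that each summand can be differentiated: the first
    because \<open>phi\<close> is parallel, the second by the Weingarten formula for the tangent
    field \<open>T Y\<close>.\<close>
  have F_eq: "(\<lambda>q. F_op M N f q (Y q)) = (\<lambda>q. phi N (f q) (?W q) - df q (?T q))"
    by (simp add: F_op_def T_op_def normal_part_def)
  have DF: "D p (X p) (\<lambda>q. F_op M N f q (Y q)) = phi N (f p) ?DW - D p (X p) (\<lambda>q. df q (?T q))"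
    unfolding F_eq
    by (subst D_diff[OF open_UNIV \<phi>W dfT UNIV_I]) (simp add: D_phi(2)[OF open_UNIV W])
  have "g (f p) (deriv_F M N f D X Y p) (V p) =
      g (f p) (phi N (f p) ?DW - D p (X p) (\<lambda>q. df q (?T q))) (V p)
      - g (f p) (phi N (f p) (df p (tan_part p ?DW))) (V p)"
    by (simp add: deriv_F_def normal_connection_def F_op_def[of M N f p] induced_connection_def
        bilinear_lsub[OF g_bilinear] g_nor_part[OF V_p] DF)
  \<comment> \<open>Subtracting \<open>phi\<close> of the tangential part of \<open>?DW\<close>
    leaves \<open>phi\<close> of its normal part, that is \<open>phi (h (X, Y))\<close>.\<close>
  also have "\<dots> = g (f p) (phi N (f p) (nor_part p ?DW)) (V p) - g (f p) (D p (X p) (\<lambda>q. df q (?T q))) (V p)"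
    by (simp add: normal_part_def bilinear_lsub[OF g_bilinear] linear_diff[OF phi(1)])
  also have "g (f p) (phi N (f p) (nor_part p ?DW)) (V p) = - g (f p) (nor_part p ?DW) (phi N (f p) (V p))"
    by (rule phi(4))
  \<comment> \<open>Since \<open>h (X, Y)\<close> is normal, only the normal part \<open>C V\<close>
    of \<open>phi V\<close> contributes.\<close>
  also have "g (f p) (nor_part p ?DW) (phi N (f p) (V p)) = g (f p) (nor_part p ?DW) (?C p)"
    using g_nor_part[OF nor_part_normal, of p "phi N (f p) (V p)" ?DW] by (simp add: C_op_def g_sym)
  also have "\<dots> = g (f p) (?C p) ?DW"
    using g_nor_part[of "?C p" p ?DW] nor_part_normal by (simp add: C_op_def g_sym)
  also have "\<dots> = m p (shape_operator M N f D ?C Y p) (X p)"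
    using m_shape_operator[OF C X] second_fundamental_form_symmetric[OF X Y, of "?C p" p] nor_part_normal
    by (simp add: C_op_def)
  also have "g (f p) (D p (X p) (\<lambda>q. df q (?T q))) (V p) = m p (shape_operator M N f D V X p) (?T p)"
    using m_shape_operator[OF V T] by (simp add: g_sym)
  finally show ?thesis .
qed

text \<open>Normality holds because both terms are normal parts. Smoothness holds because
  \<open>D\<close> along a smooth field, the projections and \<open>phi\<close> all preserve smooth
  fields.\<close>

lemma deriv_F_normal:
  assumes X: "X \<in> tangent_fields M" and Y: "Y \<in> tangent_fields M"
  shows "deriv_F M N f D X Y \<in> normal_fields M N f"
proof -
  have X': "smooth_field (atlas M) UNIV X" using X by (simp add: tangent_fields_def)
  have W: "smooth_along (atlas M) (atlas N) f UNIV (\<lambda>q. df q (Y q))"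
    using Y by (auto simp: tangent_fields_def intro: smooth_along_df)
  have F: "smooth_along (atlas M) (atlas N) f UNIV (\<lambda>q. F_op M N f q (Z q))"
    if "smooth_field (atlas M) UNIV Z" for Z
    unfolding F_op_def
    by (rule smooth_nor_part[OF open_UNIV D_phi(1)[OF open_UNIV smooth_along_df[OF open_UNIV that]]])
  have "smooth_along (atlas M) (atlas N) f UNIV (deriv_F M N f D X Y)"
    unfolding deriv_F_def[abs_def] normal_connection_def induced_connection_def
    using Y by (intro smooth_along_diff smooth_nor_part D_smooth F smooth_tan_part W X' open_UNIV)
      (auto simp: tangent_fields_def)
  moreover have "deriv_F M N f D X Y p \<in> normal_space M N f p" for p
    using normal_spaceD[OF nor_part_normal]
    by (simp add: normal_space_def deriv_F_def normal_connection_def F_op_def[of M N f p] bilinear_lsub[OF g_bilinear])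
  ultimately show ?thesis by (simp add: normal_fields_def)
qed

lemma F_parallel_iff:
  "F_parallel M N f D \<longleftrightarrow>
    (\<forall>Z1\<in>tangent_fields M. \<forall>Z2\<in>tangent_fields M. \<forall>V\<in>normal_fields M N f. \<forall>p.
       m p (shape_operator M N f D (\<lambda>q. C_op M N f q (V q)) Z2 p) (Z1 p) =
       - m p (shape_operator M N f D V Z1 p) (T_op M N f p (Z2 p)))"
    (is "_ \<longleftrightarrow> ?shape")
proof
  assume par: "F_parallel M N f D"
  show ?shape
  proof (intro ballI allI)
    fix Z1 Z2 V p assume Z: "Z1 \<in> tangent_fields M" "Z2 \<in> tangent_fields M" "V \<in> normal_fields M N f"
    have "deriv_F M N f D Z1 Z2 p = 0" using par Z by (simp add: F_parallel_def)
    then show "m p (shape_operator M N f D (\<lambda>q. C_op M N f q (V q)) Z2 p) (Z1 p) =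
       - m p (shape_operator M N f D V Z1 p) (T_op M N f p (Z2 p))"
      using deriv_F_eq_shape_operator[OF Z, of p] by (simp add: bilinear_lzero[OF g_bilinear])
  qed
next
  assume shape: ?shape
  show "F_parallel M N f D"
    unfolding F_parallel_def
  proof (intro ballI allI)
    fix X Y p assume XY: "X \<in> tangent_fields M" "Y \<in> tangent_fields M"
    note V = deriv_F_normal[OF XY]
    \<comment> \<open>The instance \<open>V = deriv_F M N f D X Y\<close> of the pairing formula:
      the assumed identity makes its two terms cancel.\<close>
    have "g (f p) (deriv_F M N f D X Y p) (deriv_F M N f D X Y p) = 0"
      using deriv_F_eq_shape_operator[OF XY V, of p] shape XY V by simp
    then show "deriv_F M N f D X Y p = 0"
      using riemannian_manifoldD(4)[OF riemannian_N] by (metis less_irrefl)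
  qed
qed

end

theorem theorem5p3:
  fixes M :: "('m::{t2_space, second_countable_topology}, 'd::euclidean_space) riem"
    and N :: "('n::{t2_space, second_countable_topology}, 'e::euclidean_space) acm"
    and f :: "'m \<Rightarrow> 'n"
    and nabla :: "'n \<Rightarrow> 'e \<Rightarrow> ('n \<Rightarrow> 'e) \<Rightarrow> 'e"
    and D :: "'m \<Rightarrow> 'd \<Rightarrow> ('m \<Rightarrow> 'e) \<Rightarrow> 'e"
  assumes "cosymplectic N nabla"
    and "proper_quasi_bi_slant M N f"
    and "pullback_connection (atlas M) (atlas N) f nabla D"
  shows "F_parallel M N f D \<longleftrightarrow>
    (\<forall>Z1\<in>tangent_fields M. \<forall>Z2\<in>tangent_fields M. \<forall>V\<in>normal_fields M N f. \<forall>p.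
       metric M p (shape_operator M N f D (\<lambda>q. C_op M N f q (V q)) Z2 p) (Z1 p) =
       - metric M p (shape_operator M N f D V Z1 p) (T_op M N f p (Z2 p)))"
proof -
  have imm: "isometric_immersion M N f"
    using assms(2) by (auto simp: proper_quasi_bi_slant_def quasi_bi_slant_def)
  then have riem: "riemannian_manifold M" "riemannian_manifold N" "smooth_map (atlas M) (atlas N) f"
    by (auto simp: isometric_immersion_def)
  interpret cosymplectic_immersion M N f nabla D
    using assms imm riem riemannian_manifoldD(1)[OF riem(1)] riemannian_manifoldD(1)[OF riem(2)]
    by unfold_locales (auto simp: cosymplectic_def)
  show ?thesis by (rule F_parallel_iff)
qed

end
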